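(* Consider the linear-quadratic isoperimetric minimization problem described in the context, posed on a finite-dimensional control space $\mathcal H\subset L^2(0,T;\mathbb R^m)$, with cost $f(u)=J_{\rm LQ}(u)=\tfrac12\langle u,\mathcal Ru\rangle+\langle\rho_0,u\rangle+\gamma_0$, constraint functional $\mathcal C(u)=\langle u,\mathcal Du\rangle$, value function $V_{\rm LQ}(\beta)=\inf\{J_{\rm LQ}(u):u\in\mathcal H,\ \mathcal C(u)=\beta\}$, dual function $\phi_0(\mu)=\inf_{u\in\mathcal H}\{f(u)+\mu\,\mathcal C(u)\}\in[-\infty,\infty)$, and admissible dual interval $\mathsf M=\{\mu\in\mathbb R:\mathcal R+2\mu\mathcal D\succ0\}=(\underline\mu,\infty)$. Let $\beta>0$ lie in the interior of the attainable range $\mathcal C(\mathcal H)$. Then: (i) (No duality gap.) There are a dual-optimal $\mu^*=\mu^*(\beta)\in\overline{\mathsf M}=[\underline\mu,\infty)$ and a primal-optimal $u^*\in\mathcal H$ with $\mathcal C(u^* )=\beta$ such that $$V_{\rm LQ}(\beta)=f(u^* )=\phi_0(\mu^* )-\mu^*\beta=\max_{\mu\in\overline{\mathsf M}}\{\phi_0(\mu)-\mu\beta\}=\max_{\mu\in\mathbb R}\ \inf_{u\in\mathcal H}\{J_{\rm LQ}(u)+\mu(\mathcal C(u)-\beta)\}.$$ (ii) (Convexity.) $V_{\rm LQ}$ is a proper closed convex function of $\beta$ on its interval domain, being the supremum of the affine maps $\beta\mapsto\phi_0(\mu)-\mu\beta$. (iii) (Envelope.) At every differentiability point of $V_{\rm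 LQ}$, $V_{\rm LQ}'(\beta)=-\mu^*(\beta)$, and $\mu^*(\beta)$ is nonincreasing in $\beta$.
   Context: LQ data. Fix $T>0$, $x_0\in\mathbb R^n$, and measurable bounded coefficients $A(t)\in\mathbb R^{n\times n}$, $B(t)\in\mathbb R^{n\times m}$, symmetric $Q(t)\succeq0$, symmetric $R(t)\succeq\rho I$, symmetric $D(t)\succeq dI$ for a.e. $t$, with constants $\rho,d>0$, and a symmetric matrix $M\succeq0$. For a control $u$, $x=x_u$ solves $\dot x=A(t)x+B(t)u$, $x(0)=x_0$, and $$J_{\rm LQ}(u)=\tfrac12x(T)^\top Mx(T)+\tfrac12\int_0^T[x^\top Q(t)x+u^\top R(t)u]\,dt,\qquad \mathcal C(u)=\int_0^Tu^\top D(t)u\,dt.$$ Controls range over a finite-dimensional subspace $\mathcal H\subset L^2(0,T;\mathbb R^m)$ (e.g. a Galerkin space) with the $L^2$ inner product $\langle\cdot,\cdot\rangle$. Since $u\mapsto x_u$ is affine, there are unique self-adjoint operators $\mathcal R,\mathcal D$ on $\mathcal H$ (symmetric matrices), $\rho_0\in\mathcal H$ and $\gamma_0\in\mathbb R$ with $J_{\rm LQ}(u)=\tfrac12\langle u,\mathcal Ru\rangle+\langle\rho_0,u\rangle+\gamma_0=:f(u)$ and $\mathcal C(u)=\langle u,\mathcal Du\rangle$ for all $u\in\mathcal H$; both $\mathcal R$ and $\mathcal D$ are positive definite. The endpoint is $\underline\mu=-\tfrac12\lambda_{\min}(\mathcal D^{-1/2}\mathcal R\mathcal D^{-1/2})<0$.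 $V_{\rm LQ}(\beta)=+\infty$ when $\beta\notin\mathcal C(\mathcal H)$. "Dual-optimal" at $\beta$ means $\mu$ attains $\sup_{\mu\in\mathbb R}\{\phi_0(\mu)-\mu\beta\}$; $\mu^*(\beta)$ denotes a dual-optimal multiplier at $\beta$. *)

theory Defs
  imports "HOL-Analysis.Analysis"
begin

section \<open>The Hilbert space of square-integrable functions on the line\<close>

definition square_integrable :: "(real \<Rightarrow> 'a::euclidean_space) \<Rightarrow> bool" where
  "square_integrable f \<longleftrightarrow>
     f \<in> borel_measurable lebesgue \<and> integrable lebesgue (\<lambda>t. (norm (f t))\<^sup>2)"

definition L2_rel :: "(real \<Rightarrow> 'a::euclidean_space) \<Rightarrow> (real \<Rightarrow> 'a) \<Rightarrow> bool" where
  "L2_rel f g \<longleftrightarrow> square_integrable f \<and> square_integrable g \<and> (AE t in lebesgue. f t = g t)"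

lemma square_integrable_0: "square_integrable (\<lambda>t. 0)"
  by (simp add: square_integrable_def)

lemma square_integrable_add:
  assumes "square_integrable f" "square_integrable g"
  shows "square_integrable (\<lambda>t. f t + g t)"
proof -
  have [measurable]: "f \<in> borel_measurable lebesgue" "g \<in> borel_measurable lebesgue"
    using assms by (auto simp: square_integrable_def)
  have "integrable lebesgue (\<lambda>t. (norm (f t + g t))\<^sup>2)"
  proof (rule Bochner_Integration.integrable_bound)
    show "integrable lebesgue (\<lambda>t. 2 * (norm (f t))\<^sup>2 + 2 * (norm (g t))\<^sup>2)"
      using assms by (auto simp: square_integrable_def)
    show "AE t in lebesgue. norm ((norm (f t + g t))\<^sup>2) \<le> norm (2 * (norm (f t))\<^sup>2 + 2 * (norm (g t))\<^sup>2)"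
    proof (rule AE_I2)
      fix t
      have "(norm (f t + g t))\<^sup>2 \<le> (norm (f t) + norm (g t))\<^sup>2"
        by (intro power_mono norm_triangle_ineq) auto
      also have "\<dots> \<le> 2 * (norm (f t))\<^sup>2 + 2 * (norm (g t))\<^sup>2"
        using sum_squares_bound[of "norm (f t)" "norm (g t)"] by (simp add: power2_sum)
      finally show "norm ((norm (f t + g t))\<^sup>2) \<le> norm (2 * (norm (f t))\<^sup>2 + 2 * (norm (g t))\<^sup>2)"
        by simp
    qed
  qed simp
  thus ?thesis by (simp add: square_integrable_def)
qed

lemma square_integrable_scaleR:
  assumes "square_integrable f"
  shows "square_integrable (\<lambda>t. c *\<^sub>R f t)"
  using assms by (auto simp: square_integrable_def power_mult_distrib)

lemma square_integrable_uminus: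
  assumes "square_integrable f"
  shows "square_integrable (\<lambda>t. - f t)"
  using square_integrable_scaleR[OF assms, of "-1"] by simp

lemma square_integrable_diff:
  assumes "square_integrable f" "square_integrable g"
  shows "square_integrable (\<lambda>t. f t - g t)"
  using square_integrable_add[OF assms(1) square_integrable_uminus[OF assms(2)]] by simp

lemma square_integrable_inner:
  assumes "square_integrable f" "square_integrable g"
  shows "integrable lebesgue (\<lambda>t. f t \<bullet> g t)"
proof -
  have [measurable]: "f \<in> borel_measurable lebesgue" "g \<in> borel_measurable lebesgue"
    using assms by (auto simp: square_integrable_def)
  show ?thesis
  proof (rule Bochner_Integration.integrable_bound)
    show "integrable lebesgue (\<lambda>t. (norm (f t))\<^sup>2 + (norm (g t))\<^sup>2)"
      using assms by (auto simp: square_integrable_def)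
    show "AE t in lebesgue. norm (f t \<bullet> g t) \<le> norm ((norm (f t))\<^sup>2 + (norm (g t))\<^sup>2)"
    proof (rule AE_I2)
      fix t
      have "\<bar>f t \<bullet> g t\<bar> \<le> norm (f t) * norm (g t)"
        by (rule Cauchy_Schwarz_ineq2)
      also have "\<dots> \<le> (norm (f t))\<^sup>2 + (norm (g t))\<^sup>2"
      proof -
        have "0 \<le> norm (f t) * norm (g t)" by simp
        thus ?thesis
          using sum_squares_bound[of "norm (f t)" "norm (g t)"] by linarith
      qed
      finally show "norm (f t \<bullet> g t) \<le> norm ((norm (f t))\<^sup>2 + (norm (g t))\<^sup>2)"
        by simp
    qed
  qed simp
qed

lemma part_equivp_L2_rel: "part_equivp (L2_rel :: (real \<Rightarrow> 'a::euclidean_space) \<Rightarrow> _)"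
proof (rule part_equivpI)
  show "\<exists>f::real \<Rightarrow> 'a. L2_rel f f"
    by (auto simp: L2_rel_def intro!: exI[of _ "\<lambda>t. 0"] square_integrable_0)
  show "symp (L2_rel :: (real \<Rightarrow> 'a) \<Rightarrow> _)"
    by (auto simp: symp_def L2_rel_def elim: eventually_mono)
  show "transp (L2_rel :: (real \<Rightarrow> 'a) \<Rightarrow> _)"
    by (auto simp: transp_def L2_rel_def elim: eventually_elim2)
qed

quotient_type (overloaded) 'a L2 = "real \<Rightarrow> 'a::euclidean_space" / partial: L2_rel
  by (rule part_equivp_L2_rel)

instantiation L2 :: (euclidean_space) real_vector
begin

lift_definition zero_L2 :: "'a L2" is "\<lambda>t. 0"
  by (simp add: L2_rel_def square_integrable_0)

lift_definition plus_L2 :: "'a L2 \<Rightarrow> 'a L2 \<Rightarrow> 'a L2" is "\<lambda>f g t. f t + g t"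
  by (auto simp: L2_rel_def intro: square_integrable_add elim: eventually_elim2)

lift_definition uminus_L2 :: "'a L2 \<Rightarrow> 'a L2" is "\<lambda>f t. - f t"
  by (auto simp: L2_rel_def intro: square_integrable_uminus elim: eventually_mono)

lift_definition minus_L2 :: "'a L2 \<Rightarrow> 'a L2 \<Rightarrow> 'a L2" is "\<lambda>f g t. f t - g t"
  by (auto simp: L2_rel_def intro: square_integrable_diff elim: eventually_elim2)

lift_definition scaleR_L2 :: "real \<Rightarrow> 'a L2 \<Rightarrow> 'a L2" is "\<lambda>c f t. c *\<^sub>R f t"
  by (auto simp: L2_rel_def intro: square_integrable_scaleR elim: eventually_mono)

instance
proof
  fix u v w :: "'a L2" and a b :: real
  note rel = L2_rel_def square_integrable_add square_integrable_scaleR square_integrable_uminus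
    square_integrable_diff square_integrable_0
  show "u + v + w = u + (v + w)"
    by transfer (auto simp: rel add.assoc)
  show "u + v = v + u"
    by transfer (auto simp: rel add.commute)
  show "0 + u = u" "- u + u = 0" "u - v = u + - v"
    by (transfer, auto simp: rel)+
  show "a *\<^sub>R (u + v) = a *\<^sub>R u + a *\<^sub>R v" "(a + b) *\<^sub>R u = a *\<^sub>R u + b *\<^sub>R u"
    by (transfer, auto simp: rel scaleR_add_right scaleR_add_left)+
  show "a *\<^sub>R b *\<^sub>R u = (a * b) *\<^sub>R u" "1 *\<^sub>R u = u"
    by (transfer, auto simp: rel)+
qed

end

instantiation L2 :: (euclidean_space) real_inner
begin

lift_definition inner_L2 :: "'a L2 \<Rightarrow> 'a L2 \<Rightarrow> real" is
  "\<lambda>f g. LINT t|lebesgue. f t \<bullet> g t"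
proof -
  fix f f' g g' :: "real \<Rightarrow> 'a"
  assume "L2_rel f f'" "L2_rel g g'"
  hence m [measurable]: "f \<in> borel_measurable lebesgue" "f' \<in> borel_measurable lebesgue"
      "g \<in> borel_measurable lebesgue" "g' \<in> borel_measurable lebesgue"
    and ae: "AE t in lebesgue. f t = f' t" "AE t in lebesgue. g t = g' t"
    by (auto simp: L2_rel_def square_integrable_def)
  show "(LINT t|lebesgue. f t \<bullet> g t) = (LINT t|lebesgue. f' t \<bullet> g' t)"
    by (rule integral_cong_AE) (use ae in \<open>auto elim: eventually_elim2\<close>)
qed

definition norm_L2 :: "'a L2 \<Rightarrow> real" where "norm_L2 u = sqrt (u \<bullet> u)"
definition dist_L2 :: "'a L2 \<Rightarrow> 'a L2 \<Rightarrow> real" where "dist_L2 u v = norm (u - v)"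
definition sgn_L2 :: "'a L2 \<Rightarrow> 'a L2" where "sgn_L2 u = u /\<^sub>R norm u"
definition uniformity_L2 :: "('a L2 \<times> 'a L2) filter" where
  "uniformity_L2 = (INF e\<in>{0<..}. principal {(u, v). dist u v < e})"
definition open_L2 :: "'a L2 set \<Rightarrow> bool" where
  "open_L2 U \<longleftrightarrow> (\<forall>u\<in>U. eventually (\<lambda>(u', v). u' = u \<longrightarrow> v \<in> U) uniformity)"

instance
proof
  fix u v w :: "'a L2" and a :: real
  show "dist u v = norm (u - v)" by (rule dist_L2_def)
  show "sgn u = u /\<^sub>R norm u" by (rule sgn_L2_def)
  show "uniformity = (INF e\<in>{0<..}. principal {(u::'a L2, v). dist u v < e})"
    by (rule uniformity_L2_def)
  show "open U = (\<forall>u\<in>U. \<forall>\<^sub>F (u', v) in uniformity. u' = u \<longrightarrow> v \<in> U)" for U :: "'a L2 set"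
    by (rule open_L2_def)
  show "u \<bullet> v = v \<bullet> u"
    by transfer (simp add: inner_commute)
  show "(u + v) \<bullet> w = u \<bullet> w + v \<bullet> w"
    by transfer (auto simp: L2_rel_def inner_add_left square_integrable_inner)
  show "(a *\<^sub>R u) \<bullet> v = a * (u \<bullet> v)"
    by transfer simp
  show "0 \<le> u \<bullet> u"
    by transfer simp
  show "u \<bullet> u = 0 \<longleftrightarrow> u = 0"
  proof transfer
    fix f :: "real \<Rightarrow> 'a"
    assume "L2_rel f f"
    hence f: "square_integrable f" by (simp add: L2_rel_def)
    show "(LINT t|lebesgue. f t \<bullet> f t) = 0 \<longleftrightarrow> L2_rel f (\<lambda>t. 0)"
      using f integral_nonneg_eq_0_iff_AE[OF square_integrable_inner[OF f f]]
      by (simp add: L2_rel_def square_integrable_0)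
  qed
  show "norm u = sqrt (u \<bullet> u)" by (rule norm_L2_def)
qed

end

text \<open>\<open>L\<^sup>2(0,T)\<close> is embedded isometrically in \<open>L\<^sup>2\<close> of the line through extension by zero,
  because a HOL type cannot depend on \<open>T\<close>. The term \<open>rep_L2 u\<close> is one square-integrable
  representative of the class \<open>u\<close>; below it occurs only inside integrals.\<close>

definition L2_on :: "real \<Rightarrow> 'a::euclidean_space L2 set" where
  "L2_on T = {u. AE t in lebesgue. t \<notin> {0<..<T} \<longrightarrow> rep_L2 u t = 0}"


section \<open>Self-adjoint operators on a subspace of an inner product space\<close>

definition self_adjoint_on :: "'a::real_inner set \<Rightarrow> ('a \<Rightarrow> 'a) \<Rightarrow> bool" where
  "self_adjoint_on H F \<longleftrightarrow>
     (\<forall>u\<in>H. F u \<in> H) \<and>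
     (\<forall>u\<in>H. \<forall>v\<in>H. F (u + v) = F u + F v) \<and>
     (\<forall>c. \<forall>u\<in>H. F (c *\<^sub>R u) = c *\<^sub>R F u) \<and>
     (\<forall>u\<in>H. \<forall>v\<in>H. F u \<bullet> v = u \<bullet> F v)"

definition pos_semidef_on :: "'a::real_inner set \<Rightarrow> ('a \<Rightarrow> 'a) \<Rightarrow> bool" where
  "pos_semidef_on H F \<longleftrightarrow> self_adjoint_on H F \<and> (\<forall>u\<in>H. 0 \<le> u \<bullet> F u)"

definition pos_def_on :: "'a::real_inner set \<Rightarrow> ('a \<Rightarrow> 'a) \<Rightarrow> bool" where
  "pos_def_on H F \<longleftrightarrow> self_adjoint_on H F \<and> (\<forall>u\<in>H. u \<noteq> 0 \<longrightarrow> 0 < u \<bullet> F u)"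

definition eigenvalues_on :: "'a::real_inner set \<Rightarrow> ('a \<Rightarrow> 'a) \<Rightarrow> real set" where
  "eigenvalues_on H F = {l. \<exists>u\<in>H. u \<noteq> 0 \<and> F u = l *\<^sub>R u}"

definition lambda_min_on :: "'a::real_inner set \<Rightarrow> ('a \<Rightarrow> 'a) \<Rightarrow> real" where
  "lambda_min_on H F = Min (eigenvalues_on H F)"

text \<open>Operators on \<open>H\<close> are total functions of which only the values on \<open>H\<close> matter. On a
  finite-dimensional \<open>H\<close> these values of the square root of a positive semidefinite operator
  are unique, so the choice below is harmless.\<close>

definition sqrt_on :: "'a::real_inner set \<Rightarrow> ('a \<Rightarrow> 'a) \<Rightarrow> 'a \<Rightarrow> 'a" where
  "sqrt_on H F = (SOME S. pos_semidef_on H S \<and> (\<forall>u\<in>H. S (S u) = F u))"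

definition inv_sqrt_on :: "'a::real_inner set \<Rightarrow> ('a \<Rightarrow> 'a) \<Rightarrow> 'a \<Rightarrow> 'a" where
  "inv_sqrt_on H F = inv_into H (sqrt_on H F)"


section \<open>Convexity of extended real functions\<close>

definition ereal_epigraph :: "('a \<Rightarrow> ereal) \<Rightarrow> ('a \<times> real) set" where
  "ereal_epigraph f = {(x, r). f x \<le> ereal r}"

definition proper_closed_convex :: "('a::real_normed_vector \<Rightarrow> ereal) \<Rightarrow> bool" where
  "proper_closed_convex f \<longleftrightarrow>
     (\<exists>x. f x < \<infinity>) \<and> (\<forall>x. - \<infinity> < f x) \<and>
     closed (ereal_epigraph f) \<and> convex (ereal_epigraph f)"

text \<open>\<open>is_max g S v\<close>: the maximum of \<open>g\<close> over \<open>S\<close> exists, i.e. is attained, and equals \<open>v\<close>.\<close>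

definition is_max :: "('a \<Rightarrow> 'b::linorder) \<Rightarrow> 'a set \<Rightarrow> 'b \<Rightarrow> bool" where
  "is_max g S v \<longleftrightarrow> (\<exists>x\<in>S. g x = v) \<and> (\<forall>x\<in>S. g x \<le> v)"


section \<open>The linear-quadratic isoperimetric problem\<close>

record ('n, 'm) lq_data =
  horizon :: real
  init :: "real^'n"
  matA :: "real \<Rightarrow> real^'n^'n"
  matB :: "real \<Rightarrow> real^'m^'n"
  matQ :: "real \<Rightarrow> real^'n^'n"
  matR :: "real \<Rightarrow> real^'m^'m"
  matD :: "real \<Rightarrow> real^'m^'m"
  matM :: "real^'n^'n"

definition pos_semidef_mat :: "real^'n^'n \<Rightarrow> bool" where
  "pos_semidef_mat S \<longleftrightarrow> transpose S = S \<and> (\<forall>v. 0 \<le> v \<bullet> (S *v v))"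

text \<open>Boundedness of the coefficients is essential boundedness.\<close>

definition bounded_measurable :: "real \<Rightarrow> (real \<Rightarrow> 'a::euclidean_space) \<Rightarrow> bool" where
  "bounded_measurable T F \<longleftrightarrow>
     F \<in> borel_measurable (lebesgue_on {0..T}) \<and>
     (\<exists>K. AE t in lebesgue_on {0..T}. norm (F t) \<le> K)"

text \<open>Note that \<open>mat \<rho>\<close> is \<open>\<rho>\<close> times the identity matrix.\<close>

definition lq_admissible :: "('n::finite, 'm::finite) lq_data \<Rightarrow> real \<Rightarrow> real \<Rightarrow> bool" where
  "lq_admissible P \<rho> d \<longleftrightarrow>
     0 < horizon P \<and> 0 < \<rho> \<and> 0 < d \<and>
     bounded_measurable (horizon P) (matA P) \<and>
     bounded_measurable (horizon P) (matB P) \<and>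
     bounded_measurable (horizon P) (matQ P) \<and>
     bounded_measurable (horizon P) (matR P) \<and>
     bounded_measurable (horizon P) (matD P) \<and>
     (AE t in lebesgue_on {0..horizon P}. pos_semidef_mat (matQ P t)) \<and>
     (AE t in lebesgue_on {0..horizon P}. pos_semidef_mat (matR P t - mat \<rho>)) \<and>
     (AE t in lebesgue_on {0..horizon P}. pos_semidef_mat (matD P t - mat d)) \<and>
     pos_semidef_mat (matM P)"

text \<open>The state equation has merely measurable coefficients, so its solutions are meant in the
  sense of Caratheodory: the integral equation says that \<open>x\<close> is absolutely continuous on
  \<open>[0,T]\<close>, satisfies the differential equation almost everywhere, and starts at \<open>x\<^sub>0\<close>.\<close>

definition solves_state :: "('n::finite, 'm::finite) lq_data \<Rightarrow> (real^'m) L2 \<Rightarrow> (real \<Rightarrow> real^'n) \<Rightarrow> bool" where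
  "solves_state P u x \<longleftrightarrow>
     integrable (lebesgue_on {0..horizon P}) (\<lambda>s. matA P s *v x s + matB P s *v rep_L2 u s) \<and>
     (\<forall>t\<in>{0..horizon P}.
        x t = init P + (LINT s|lebesgue_on {0..t}. matA P s *v x s + matB P s *v rep_L2 u s))"

text \<open>The solution is unique on \<open>[0,T]\<close>, and only its values there are used.\<close>

definition lq_state :: "('n::finite, 'm::finite) lq_data \<Rightarrow> (real^'m) L2 \<Rightarrow> real \<Rightarrow> real^'n" where
  "lq_state P u = (SOME x. solves_state P u x)"

definition lq_cost :: "('n::finite, 'm::finite) lq_data \<Rightarrow> (real^'m) L2 \<Rightarrow> real" where
  "lq_cost P u =
     1/2 * (lq_state P u (horizon P) \<bullet> (matM P *v lq_state P u (horizon P))) +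
     1/2 * (LINT t|lebesgue_on {0..horizon P}.
              lq_state P u t \<bullet> (matQ P t *v lq_state P u t) +
              rep_L2 u t \<bullet> (matR P t *v rep_L2 u t))"

definition lq_constraint :: "('n::finite, 'm::finite) lq_data \<Rightarrow> (real^'m) L2 \<Rightarrow> real" where
  "lq_constraint P u =
     (LINT t|lebesgue_on {0..horizon P}. rep_L2 u t \<bullet> (matD P t *v rep_L2 u t))"

text \<open>The operators \<open>\<R>\<close> and \<open>\<D>\<close> on \<open>H\<close>; their values on \<open>H\<close> are uniquely determined.\<close>

definition lq_cost_op ::
    "('n::finite, 'm::finite) lq_data \<Rightarrow> (real^'m) L2 set \<Rightarrow> (real^'m) L2 \<Rightarrow> (real^'m) L2" where
  "lq_cost_op P H = (SOME F. self_adjoint_on H F \<and>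
     (\<exists>r\<in>H. \<exists>g. \<forall>u\<in>H. lq_cost P u = 1/2 * (u \<bullet> F u) + r \<bullet> u + g))"

definition lq_constraint_op ::
    "('n::finite, 'm::finite) lq_data \<Rightarrow> (real^'m) L2 set \<Rightarrow> (real^'m) L2 \<Rightarrow> (real^'m) L2" where
  "lq_constraint_op P H = (SOME F. self_adjoint_on H F \<and> (\<forall>u\<in>H. lq_constraint P u = u \<bullet> F u))"

definition lq_value :: "('n::finite, 'm::finite) lq_data \<Rightarrow> (real^'m) L2 set \<Rightarrow> real \<Rightarrow> ereal" where
  "lq_value P H \<beta> = (INF u\<in>{u\<in>H. lq_constraint P u = \<beta>}. ereal (lq_cost P u))"

definition lq_dual :: "('n::finite, 'm::finite) lq_data \<Rightarrow> (real^'m) L2 set \<Rightarrow> real \<Rightarrow> ereal" where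
  "lq_dual P H \<mu> = (INF u\<in>H. ereal (lq_cost P u + \<mu> * lq_constraint P u))"

definition dual_optimal :: "('n::finite, 'm::finite) lq_data \<Rightarrow> (real^'m) L2 set \<Rightarrow> real \<Rightarrow> real \<Rightarrow> bool" where
  "dual_optimal P H \<beta> \<mu> \<longleftrightarrow>
     lq_dual P H \<mu> - ereal (\<mu> * \<beta>) = (SUP \<nu>. lq_dual P H \<nu> - ereal (\<nu> * \<beta>))"

definition dual_interval :: "('n::finite, 'm::finite) lq_data \<Rightarrow> (real^'m) L2 set \<Rightarrow> real set" where
  "dual_interval P H =
     {\<mu>. pos_def_on H (\<lambda>u. lq_cost_op P H u + (2 * \<mu>) *\<^sub>R lq_constraint_op P H u)}"

definition dual_endpoint :: "('n::finite, 'm::finite) lq_data \<Rightarrow> (real^'m) L2 set \<Rightarrow> real" where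
  "dual_endpoint P H =
     - (1/2) * lambda_min_on H
       (\<lambda>u. inv_sqrt_on H (lq_constraint_op P H)
              (lq_cost_op P H (inv_sqrt_on H (lq_constraint_op P H) u)))"

end

theory Submission
  imports Defs
begin

text \<open>
  On \<open>H\<close> the problem is to minimize a positive definite quadratic function \<open>f\<close> over the ellipsoid
  \<open>u \<bullet> \<D>u = \<beta>\<close>. By compactness a minimizer \<open>u\<close> exists; it satisfies the multiplier rule
  \<open>\<R>u + \<rho>\<^sub>0 + 2\<mu>\<D>u = 0\<close>. For every other point \<open>v\<close> of the ellipsoid, stationarity gives
  \<open>0 \<le> f v - f u = (v - u) \<bullet> (\<R> + 2\<mu>\<D>)(v - u) / 2\<close>, and almost every direction is a multiple of such a
  \<open>v - u\<close>. Hence \<open>\<R> + 2\<mu>\<D>\<close> is positive semidefinite, the Lagrangian is convex and \<open>u\<close> minimizes it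
  globally. So there is no duality gap although the constraint is not convex, and convexity and the
  envelope formula follow because the value function is a supremum of affine functions. For
  \<open>\<beta> \<le> 0\<close> the supremum is approached as \<open>\<mu> \<rightarrow> \<infinity>\<close>. That the cost is quadratic in the control
  rests on existence and uniqueness for the state equation, proved by Picard iteration.
\<close>

section \<open>Finite-dimensional subspaces\<close>

text \<open>The control type is infinite-dimensional and \<open>H\<close> is only a subset of it, so
  compactness, Riesz representation and the spectral theorem are obtained relative to
  \<open>H\<close>, from an orthonormal basis. Operators are constrained on \<open>H\<close> alone,
  and those of the problem are arbitrary choices satisfying a specification; every use goes through
  that specification and the values on \<open>H\<close>.

  The obstacle in the duality argument is the endpoint of the multiplier interval: there the Hessian
  of the Lagrangian is singular, and a minimizer cannot be found by inverting it and then adjusting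
  the multiplier. Starting from a primal minimizer treats the singular and the regular case alike.
  The same minimization result, with the identity as constraint operator and no linear term, yields
  the least eigenvalue, and from it come the eigenbasis, the square root of the constraint operator
  and the formula for the endpoint.\<close>

locale orthonormal_span =
  fixes H E :: "'a::real_inner set"
  assumes finite_E: "finite E" and orthogonal_E: "pairwise orthogonal E"
    and norm_E: "\<And>e. e \<in> E \<Longrightarrow> norm e = 1" and span_E: "span E = H"
begin

lemma subspace_H: "subspace H"
  using span_E subspace_span by blast

lemmas H_closed = subspace_add[OF subspace_H] subspace_diff[OF subspace_H]
  subspace_scale[OF subspace_H] subspace_0[OF subspace_H] subspace_neg[OF subspace_H]
  subspace_sum[OF subspace_H]

lemma E_subset: "E \<subseteq> H"
  using span_E span_superset by blast

lemma inner_E: "e \<in> E \<Longrightarrow> e' \<in> E \<Longrightarrow> e \<bullet> e' = (if e = e' then 1 else 0)"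
  using orthogonal_E norm_E by (auto simp: pairwise_def orthogonal_def dot_square_norm)

lemma expand: "u \<in> H \<Longrightarrow> (\<Sum>e\<in>E. (u \<bullet> e) *\<^sub>R e) = u"
  using orthonormal_basis_expand[OF orthogonal_E norm_E _ finite_E, of u] span_E
  by (simp add: inner_commute)

lemma eq_if_inner_eq:
  assumes "u \<in> H" "v \<in> H" "\<And>w. w \<in> H \<Longrightarrow> u \<bullet> w = v \<bullet> w"
  shows "u = v"
proof -
  have "(u - v) \<bullet> (u - v) = 0"
    using assms(3)[of "u - v"] assms(1,2) H_closed by (simp add: inner_diff_left)
  thus ?thesis by simp
qed

text \<open>\<open>L\<close> is linear on \<open>H\<close> only, so the induction over subsets of
  \<open>E\<close> keeps every partial sum inside \<open>H\<close>.\<close>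

lemma linear_expand:
  fixes L :: "'a \<Rightarrow> 'b::real_vector"
  assumes add: "\<And>u v. u \<in> H \<Longrightarrow> v \<in> H \<Longrightarrow> L (u + v) = L u + L v"
    and scale: "\<And>c u. u \<in> H \<Longrightarrow> L (c *\<^sub>R u) = c *\<^sub>R L u" and "u \<in> H"
  shows "L u = (\<Sum>e\<in>E. (u \<bullet> e) *\<^sub>R L e)"
proof -
  have 0: "L 0 = 0"
    using scale[of 0 0] H_closed by simp
  have "L (\<Sum>e\<in>F. (u \<bullet> e) *\<^sub>R e) = (\<Sum>e\<in>F. (u \<bullet> e) *\<^sub>R L e)" if "F \<subseteq> E" for F
    using finite_subset[OF that finite_E] that
  proof (induction F rule: finite_induct)
    case (insert e F)
    have "(\<Sum>e\<in>F. (u \<bullet> e) *\<^sub>R e) \<in> H" "e \<in> H"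
      using insert E_subset by (auto intro!: H_closed)
    thus ?case using insert by (simp add: add scale H_closed)
  qed (simp add: 0)
  from this[of E] show ?thesis using expand \<open>u \<in> H\<close> by simp
qed

lemma riesz:
  fixes L :: "'a \<Rightarrow> real"
  assumes "\<And>u v. u \<in> H \<Longrightarrow> v \<in> H \<Longrightarrow> L (u + v) = L u + L v"
    and "\<And>c u. u \<in> H \<Longrightarrow> L (c *\<^sub>R u) = c * L u"
  obtains r where "r \<in> H" "\<And>u. u \<in> H \<Longrightarrow> L u = r \<bullet> u"
proof
  show "(\<Sum>e\<in>E. L e *\<^sub>R e) \<in> H"
    using E_subset by (auto intro!: H_closed)
  show "L u = (\<Sum>e\<in>E. L e *\<^sub>R e) \<bullet> u" if "u \<in> H" for u
    using linear_expand[of L u] assms that by (simp add: inner_sum_left inner_commute[of u] mult.commute)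
qed

text \<open>For fixed \<open>v\<close>, \<open>F v\<close> is the Riesz vector of
  \<open>u \<mapsto> b u v\<close>; uniqueness of Riesz vectors makes \<open>F\<close> linear, and
  symmetry of \<open>b\<close> makes it self-adjoint. This turns the integral forms of the control
  problem into operators on \<open>H\<close>.\<close>

lemma riesz_operator:
  fixes b :: "'a \<Rightarrow> 'a \<Rightarrow> real"
  assumes sym: "\<And>u v. u \<in> H \<Longrightarrow> v \<in> H \<Longrightarrow> b u v = b v u"
    and add: "\<And>u v w. u \<in> H \<Longrightarrow> v \<in> H \<Longrightarrow> w \<in> H \<Longrightarrow> b (u + v) w = b u w + b v w"
    and scale: "\<And>c u w. u \<in> H \<Longrightarrow> w \<in> H \<Longrightarrow> b (c *\<^sub>R u) w = c * b u w"
  obtains F where "self_adjoint_on H F" "\<And>u v. u \<in> H \<Longrightarrow> v \<in> H \<Longrightarrow> b u v = u \<bullet> F v"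
proof -
  have "\<forall>v\<in>H. \<exists>r. r \<in> H \<and> (\<forall>u\<in>H. b u v = r \<bullet> u)"
    using riesz[of "\<lambda>u. b u v" for v] add scale by metis
  then obtain F where F: "\<And>v. v \<in> H \<Longrightarrow> F v \<in> H" "\<And>u v. u \<in> H \<Longrightarrow> v \<in> H \<Longrightarrow> b u v = F v \<bullet> u"
    by metis
  have add_r: "b w (u + v) = b w u + b w v" if "u \<in> H" "v \<in> H" "w \<in> H" for u v w
    using that add sym H_closed by metis
  have scale_r: "b w (c *\<^sub>R u) = c * b w u" if "u \<in> H" "w \<in> H" for u w c
    using that scale sym H_closed by metis
  show thesis
  proof
    show "self_adjoint_on H F"
      unfolding self_adjoint_on_def
    proof (intro conjI ballI allI)
      fix u v assume uv: "u \<in> H" "v \<in> H"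
      show "F (u + v) = F u + F v"
        by (rule eq_if_inner_eq)
          (use uv F in \<open>auto simp: H_closed inner_add_left add_r simp flip: F(2)\<close>)
      show "F u \<bullet> v = u \<bullet> F v"
        using F(2)[of u v] F(2)[of v u] sym[of u v] uv by (simp add: inner_commute)
    next
      fix c u assume u: "u \<in> H"
      show "F (c *\<^sub>R u) = c *\<^sub>R F u"
        by (rule eq_if_inner_eq)
          (use u F in \<open>auto simp: H_closed scale_r simp flip: F(2)\<close>)
    qed (use F in auto)
    show "b u v = u \<bullet> F v" if "u \<in> H" "v \<in> H" for u v
      using F(2)[OF that] by (simp add: inner_commute)
  qed
qed

text \<open>Heine-Borel relative to \<open>H\<close>: the box is a sum of finitely many segments,
  one for each basis vector, and sums of compact sets are compact.\<close>

lemma compact_box: "compact {u \<in> H. \<forall>e\<in>E. \<bar>u \<bullet> e\<bar> \<le> r}"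
proof -
  \<comment> \<open>Free coefficients instead of inner products let the induction insert one vector
    at a time; orthonormality enters only when \<open>K E\<close> is compared with the box.\<close>
  define K where "K F = {\<Sum>e\<in>F. a e *\<^sub>R e |a. \<forall>e\<in>F. \<bar>a e\<bar> \<le> r}" for F :: "'a set"
  have "compact (K F)" if "finite F" for F
    using that
  proof (induction F rule: finite_induct)
    case empty
    show ?case by (simp add: K_def)
  next
    case (insert e F)
    have "K (insert e F) = {x + y |x y. x \<in> (\<lambda>t. t *\<^sub>R e) ` {-r..r} \<and> y \<in> K F}" (is "_ = ?R")
    proof (intro equalityI subsetI)
      fix x assume "x \<in> K (insert e F)"
      thus "x \<in> ?R" using insert by (fastforce simp: K_def)
    next
      fix x assume "x \<in> ?R"
      then obtain t a where t: "x = t *\<^sub>R e + (\<Sum>e\<in>F. a e *\<^sub>R e)" "t \<in> {-r..r}" "\<forall>e\<in>F. \<bar>a e\<bar> \<le> r"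
        by (auto simp: K_def)
      have "(\<Sum>e\<in>F. a e *\<^sub>R e) = (\<Sum>f\<in>F. (a(e := t)) f *\<^sub>R f)"
        using insert by (intro sum.cong) auto
      hence "x = (\<Sum>f\<in>insert e F. (a(e := t)) f *\<^sub>R f)"
        using insert t by simp
      moreover have "\<forall>f\<in>insert e F. \<bar>(a(e := t)) f\<bar> \<le> r"
        using t by auto
      ultimately show "x \<in> K (insert e F)" unfolding K_def by blast
    qed
    thus ?case
      using insert by (auto intro!: compact_sums compact_continuous_image continuous_intros)
  qed
  moreover have "{u \<in> H. \<forall>e\<in>E. \<bar>u \<bullet> e\<bar> \<le> r} = K E"
  proof (intro equalityI subsetI)
    fix u assume "u \<in> {u \<in> H. \<forall>e\<in>E. \<bar>u \<bullet> e\<bar> \<le> r}"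
    thus "u \<in> K E" unfolding K_def using expand[of u] by (auto intro!: exI[of _ "\<lambda>e. u \<bullet> e"])
  next
    fix u assume "u \<in> K E"
    then obtain a where a: "u = (\<Sum>e\<in>E. a e *\<^sub>R e)" "\<forall>e\<in>E. \<bar>a e\<bar> \<le> r"
      by (auto simp: K_def)
    have "u \<bullet> e = a e" if "e \<in> E" for e
      using that a finite_E by (simp add: inner_sum_left inner_E if_distrib cong: if_cong)
    thus "u \<in> {u \<in> H. \<forall>e\<in>E. \<bar>u \<bullet> e\<bar> \<le> r}"
      using a E_subset by (auto intro!: H_closed)
  qed
  ultimately show ?thesis using finite_E by simp
qed

text \<open>The values of \<open>F\<close> off \<open>H\<close> are arbitrary, so \<open>F\<close>
  itself need not be continuous; the extension is \<open>F\<close> after orthogonal projection onto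
  \<open>H\<close>.\<close>

lemma self_adjoint_extend:
  assumes "self_adjoint_on H F"
  obtains F' where "continuous_on UNIV F'" "\<And>u. u \<in> H \<Longrightarrow> F' u = F u"
proof
  show "continuous_on UNIV (\<lambda>u. \<Sum>e\<in>E. (u \<bullet> e) *\<^sub>R F e)"
    by (intro continuous_intros)
  show "(\<Sum>e\<in>E. (u \<bullet> e) *\<^sub>R F e) = F u" if "u \<in> H" for u
    using linear_expand[of F u] assms that by (simp add: self_adjoint_on_def)
qed

text \<open>The minimizer on the ellipsoid is stationary along the curves
  \<open>cos \<theta> u + sin \<theta> w\<close>, which gives the multiplier. Every line through the minimizer that is not
  tangent to the ellipsoid meets it in a second point, and comparing the two values of the cost
  shows that the Hessian of the Lagrangian is nonnegative in that direction; tangent directions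
  follow by continuity.\<close>

lemma ellipsoid_minimizer:
  assumes F: "self_adjoint_on H F" and D: "self_adjoint_on H D" and r: "r \<in> H"
    and \<delta>: "0 < \<delta>" "\<And>u. u \<in> H \<Longrightarrow> \<delta> * (u \<bullet> u) \<le> u \<bullet> D u"
    and \<beta>: "0 < \<beta>" and H: "H \<noteq> {0}"
  obtains u \<mu> where "u \<in> H" "u \<bullet> D u = \<beta>"
    "F u + r + (2 * \<mu>) *\<^sub>R D u = 0" "\<And>w. w \<in> H \<Longrightarrow> 0 \<le> w \<bullet> (F w + (2 * \<mu>) *\<^sub>R D w)"
proof -
  define f where "f u = 1/2 * (u \<bullet> F u) + r \<bullet> u" for u
  define S where "S = {u \<in> H. u \<bullet> D u = \<beta>}"
  have FH: "F u \<in> H" and DH: "D u \<in> H" if "u \<in> H" for u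
    using F D that by (auto simp: self_adjoint_on_def)
  have Flin: "F (u + v) = F u + F v" "F (c *\<^sub>R u) = c *\<^sub>R F u"
    and Dlin: "D (u + v) = D u + D v" "D (c *\<^sub>R u) = c *\<^sub>R D u" if "u \<in> H" "v \<in> H" for u v c
    using F D that by (auto simp: self_adjoint_on_def)
  have Fsym: "F u \<bullet> v = F v \<bullet> u" and Dsym: "D u \<bullet> v = D v \<bullet> u" if "u \<in> H" "v \<in> H" for u v
    using F D that by (auto simp: self_adjoint_on_def inner_commute)
  obtain F' where F': "continuous_on UNIV F'" "\<And>u. u \<in> H \<Longrightarrow> F' u = F u"
    using self_adjoint_extend[OF F] by blast
  obtain D' where D': "continuous_on UNIV D'" "\<And>u. u \<in> H \<Longrightarrow> D' u = D u"
    using self_adjoint_extend[OF D] by blast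
  \<comment> \<open>Coercivity bounds \<open>norm u\<close> by
    \<open>sqrt (\<beta> / \<delta>)\<close> on the ellipsoid, which puts it in the box;
    \<open>D'\<close> stands in for \<open>D\<close> so that the level set is closed.\<close>
  have "S = {u \<in> H. \<forall>e\<in>E. \<bar>u \<bullet> e\<bar> \<le> sqrt (\<beta> / \<delta>)} \<inter> {u. u \<bullet> D' u = \<beta>}"
  proof -
    have "\<bar>u \<bullet> e\<bar> \<le> sqrt (\<beta> / \<delta>)" if "u \<in> H" "u \<bullet> D u = \<beta>" "e \<in> E" for u e
    proof -
      have "\<bar>u \<bullet> e\<bar> \<le> norm u" using Cauchy_Schwarz_ineq2[of u e] norm_E that by simp
      also have "\<dots> = sqrt (u \<bullet> u)" by (simp add: norm_eq_sqrt_inner)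
      also have "u \<bullet> u \<le> \<beta> / \<delta>" using \<delta>(2)[of u] \<delta>(1) that by (simp add: field_simps)
      hence "sqrt (u \<bullet> u) \<le> sqrt (\<beta> / \<delta>)" by simp
      finally show ?thesis .
    qed
    thus ?thesis using D' by (auto simp: S_def)
  qed
  moreover have "closed {u. u \<bullet> D' u = \<beta>}"
    using D'(1) by (intro closed_Collect_eq continuous_intros)
  ultimately have "compact S"
    using compact_box by (simp add: compact_Int_closed)
  moreover have "continuous_on S f"
  proof -
    have "continuous_on S (\<lambda>u. 1/2 * (u \<bullet> F' u) + r \<bullet> u)"
      using continuous_on_subset[OF F'(1)] by (intro continuous_intros) auto
    moreover have "1/2 * (u \<bullet> F' u) + r \<bullet> u = f u" if "u \<in> S" for u
      using that F' by (simp add: f_def S_def)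
    ultimately show ?thesis by (simp cong: continuous_on_cong)
  qed
  moreover have normalize: "\<exists>c>0. c *\<^sub>R w \<in> S" if "w \<in> H" "w \<noteq> 0" for w
  proof -
    have p: "0 < w \<bullet> D w"
    proof -
      have "0 < \<delta> * (w \<bullet> w)" using \<delta>(1) that by simp
      thus ?thesis using \<delta>(2)[of w] that by linarith
    qed
    have "(sqrt (\<beta> / (w \<bullet> D w)))\<^sup>2 = \<beta> / (w \<bullet> D w)"
      using p \<beta> by simp
    hence "sqrt (\<beta> / (w \<bullet> D w)) *\<^sub>R w \<in> S"
      using p that by (simp add: S_def H_closed Dlin flip: power2_eq_square mult.assoc)
    thus ?thesis using p \<beta> by (intro exI[of _ "sqrt (\<beta> / (w \<bullet> D w))"]) simp
  qed
  moreover have "S \<noteq> {}"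
    using normalize H H_closed by blast
  ultimately obtain u where u: "u \<in> S" and min: "\<And>v. v \<in> S \<Longrightarrow> f u \<le> f v"
    using continuous_attains_inf[of S f] by metis
  have uH: "u \<in> H" and uD: "u \<bullet> D u = \<beta>" using u by (auto simp: S_def)
  define g where "g = F u + r"
  have gH: "g \<in> H" using uH r FH H_closed by (simp add: g_def)
  \<comment> \<open>Here \<open>w\<close> is \<open>D\<close>-orthogonal to \<open>u\<close> and
    lies on \<open>S\<close> itself, so \<open>cos\<^sup>2 + sin\<^sup>2 = 1\<close> keeps the curve
    on \<open>S\<close>; the cost along it has derivative \<open>g \<bullet> w\<close> at
    \<open>0\<close>.\<close>
  have tangent_S: "g \<bullet> w = 0" if "w \<in> S" "w \<bullet> D u = 0" for w
  proof -
    have w: "w \<in> H" "w \<bullet> D w = \<beta>" using that by (auto simp: S_def)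
    define h where "h t = f (cos t *\<^sub>R u + sin t *\<^sub>R w)" for t
    have curve: "cos t *\<^sub>R u + sin t *\<^sub>R w \<in> S" for t
    proof -
      have "(cos t *\<^sub>R u + sin t *\<^sub>R w) \<bullet> D (cos t *\<^sub>R u + sin t *\<^sub>R w)
        = (cos t)\<^sup>2 * (u \<bullet> D u) + 2 * (sin t * cos t) * (w \<bullet> D u) + (sin t)\<^sup>2 * (w \<bullet> D w)"
        using uH w Dsym[of u w] H_closed
        by (simp add: Dlin inner_simps inner_commute power2_eq_square algebra_simps)
      also have "\<dots> = \<beta>" using uD w that by (simp flip: distrib_right)
      finally show ?thesis using uH w H_closed by (simp add: S_def)
    qed
    have h_eq: "h t = 1/2 * ((cos t)\<^sup>2 * (u \<bullet> F u) + 2 * (sin t * cos t) * (w \<bullet> F u) + (sin t)\<^sup>2 * (w \<bullet> F w))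
        + cos t * (r \<bullet> u) + sin t * (r \<bullet> w)" for t
      using uH w Fsym[of u w] H_closed
      by (simp add: h_def f_def Flin inner_simps inner_commute power2_eq_square algebra_simps)
    have "(h has_real_derivative g \<bullet> w) (at 0)"
      unfolding h_eq
      by (auto intro!: derivative_eq_intros simp: g_def inner_simps inner_commute)
    moreover have "h 0 \<le> h t" for t
      using min[OF curve[of t]] by (simp add: h_def)
    ultimately show ?thesis
      using DERIV_local_min[of h "g \<bullet> w" 0 1] by auto
  qed
  have tangent: "g \<bullet> w = 0" if w: "w \<in> H" "w \<bullet> D u = 0" for w
  proof (cases "w = 0")
    case False
    then obtain c where "c > 0" "c *\<^sub>R w \<in> S" using normalize w(1) by blast
    thus ?thesis using tangent_S[of "c *\<^sub>R w"] w by simp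
  qed simp
  \<comment> \<open>The only possible value: pairing \<open>g + 2\<mu> D u = 0\<close> with
    \<open>u\<close> gives \<open>g \<bullet> u + 2\<mu>\<beta> = 0\<close>.\<close>
  define \<mu> where "\<mu> = - (g \<bullet> u) / (2 * \<beta>)"
  have stat: "g + (2 * \<mu>) *\<^sub>R D u = 0"
  proof (rule eq_if_inner_eq)
    fix w assume w: "w \<in> H"
    \<comment> \<open>The part of \<open>w\<close> tangent to the ellipsoid at \<open>u\<close>; the
      rest is a multiple of \<open>u\<close>, for which \<open>\<mu>\<close> was chosen.\<close>
    define v where "v = w - ((w \<bullet> D u) / \<beta>) *\<^sub>R u"
    have "g \<bullet> v = 0"
      using \<beta> uD by (intro tangent) (auto simp: v_def w uH H_closed inner_simps)
    thus "(g + (2 * \<mu>) *\<^sub>R D u) \<bullet> w = 0 \<bullet> w"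
      using \<beta> by (simp add: v_def \<mu>_def inner_simps inner_commute field_simps)
  qed (use gH uH DH H_closed in auto)
  define q where "q w = w \<bullet> (F w + (2 * \<mu>) *\<^sub>R D w)" for w
  have secant: "0 \<le> q w" if w: "w \<in> H" "w \<bullet> D u \<noteq> 0" for w
  proof -
    have "w \<noteq> 0" using w by auto
    hence p: "0 < w \<bullet> D w"
      using \<delta>(1) \<delta>(2)[of w] w by (smt (verit) inner_gt_zero_iff mult_pos_pos)
    \<comment> \<open>The nonzero root of
      \<open>t * (2 * (w \<bullet> D u) + t * (w \<bullet> D w)) = 0\<close>, i.e. the second
      intersection of the line with the ellipsoid.\<close>
    define t where "t = - 2 * (w \<bullet> D u) / (w \<bullet> D w)"
    have t: "t \<noteq> 0" "t * (w \<bullet> D w) = - 2 * (w \<bullet> D u)" using w p by (auto simp: t_def)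
    have "(u + t *\<^sub>R w) \<bullet> D (u + t *\<^sub>R w) = \<beta> + t * (2 * (w \<bullet> D u) + t * (w \<bullet> D w))"
      using uH w Dsym[of u w] uD H_closed
      by (simp add: Dlin inner_simps inner_commute algebra_simps)
    hence "u + t *\<^sub>R w \<in> S" using t uH w H_closed by (simp add: S_def)
    from min[OF this] have "0 \<le> t * (g \<bullet> w) + t\<^sup>2 / 2 * (w \<bullet> F w)"
      using uH w Fsym[of u w] H_closed
      by (simp add: f_def g_def Flin inner_simps inner_commute algebra_simps power2_eq_square)
    \<comment> \<open>Stationarity expresses the linear term through \<open>w \<bullet> D u\<close>,
      and \<open>t(2)\<close> replaces that by \<open>t * (w \<bullet> D w)\<close>, so the whole
      increment becomes \<open>t\<^sup>2 / 2 * q w\<close>.\<close>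
    also have "g = - ((2 * \<mu>) *\<^sub>R D u)" using stat by (simp add: eq_neg_iff_add_eq_0)
    also have "t * (- ((2 * \<mu>) *\<^sub>R D u) \<bullet> w) = \<mu> * t * (- 2 * (w \<bullet> D u))"
      by (simp add: inner_commute)
    also have "\<dots> + t\<^sup>2 / 2 * (w \<bullet> F w) = t\<^sup>2 / 2 * q w"
      unfolding t(2)[symmetric] by (simp add: q_def inner_simps power2_eq_square algebra_simps)
    finally show ?thesis using t(1) by (simp add: zero_le_mult_iff)
  qed
  have "0 \<le> q w" if w: "w \<in> H" for w
  proof (cases "w \<bullet> D u = 0")
    case True
    \<comment> \<open>Adding \<open>s *\<^sub>R u\<close> makes the direction non-tangent, since
      \<open>u \<bullet> D u = \<beta> > 0\<close>.\<close>
    have "0 \<le> q (w + s *\<^sub>R u)" if "s > 0" for s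
      using True that \<beta> w uH uD by (intro secant) (auto simp: H_closed inner_simps)
    moreover have "q (w + s *\<^sub>R u) = q w + s * (2 * (w \<bullet> F u) + 4 * \<mu> * (w \<bullet> D u)) + s\<^sup>2 * q u" for s
      using uH w Fsym[of u w] Dsym[of u w] H_closed
      by (simp add: q_def Flin Dlin inner_simps inner_commute algebra_simps power2_eq_square)
    ultimately have le: "0 \<le> q w + s * (2 * (w \<bullet> F u) + 4 * \<mu> * (w \<bullet> D u)) + s\<^sup>2 * q u" if "s > 0" for s
      using that by metis
    have "((\<lambda>s. q w + s * (2 * (w \<bullet> F u) + 4 * \<mu> * (w \<bullet> D u)) + s\<^sup>2 * q u) \<longlongrightarrow>
        q w + 0 * (2 * (w \<bullet> F u) + 4 * \<mu> * (w \<bullet> D u)) + 0\<^sup>2 * q u) (at_right 0)"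
      by (intro tendsto_intros)
    from tendsto_lowerbound[OF this, of 0] show ?thesis
      using le by (simp add: eventually_at_right_less eventually_at_filter)
  qed (use secant w in auto)
  thus thesis
    using that[of u \<mu>] uH uD stat by (simp add: g_def q_def)
qed

end

lemma orthonormal_span_exists:
  fixes H :: "'a::real_inner set"
  assumes "finite S" "span S = H"
  obtains E where "orthonormal_span H E"
proof -
  obtain C where C: "finite C" "span C = H" "pairwise orthogonal C"
    using basis_orthogonal[OF assms(1)] assms(2) by auto
  define E where "E = sgn ` (C - {0})"
  have "span E = span (C - {0})"
  proof (rule subset_antisym; rule span_minimal)
    show "E \<subseteq> span (C - {0})"
      by (auto simp: E_def sgn_div_norm intro!: span_scale intro: span_base)
    show "C - {0} \<subseteq> span E"
    proof
      fix c assume c: "c \<in> C - {0}"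
      hence "c = norm c *\<^sub>R sgn c" by (simp add: sgn_div_norm)
      thus "c \<in> span E" using c unfolding E_def by (metis image_eqI span_base span_scale)
    qed
  qed auto
  moreover have "pairwise orthogonal E"
    using C(3) by (auto simp: E_def pairwise_def orthogonal_def sgn_div_norm)
  moreover have "norm e = 1" if "e \<in> E" for e
    using that by (auto simp: E_def norm_sgn split: if_splits)
  moreover have "finite E" using C by (simp add: E_def)
  ultimately have "orthonormal_span H E"
    using C by unfold_locales (auto simp: span_delete_0)
  thus thesis using that by blast
qed

section \<open>Eigenvalues, square roots and definiteness of operator pencils on
  \<open>H\<close>\<close>

context orthonormal_span
begin

text \<open>Orthonormal vectors are independent. The bound yields finitely many eigenvalues and an
  orthonormal set of eigenvectors of largest size.\<close>

lemma orthonormal_card_le: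
  assumes "F \<subseteq> H" "pairwise orthogonal F" "\<And>e. e \<in> F \<Longrightarrow> norm e = 1"
  shows "finite F" "card F \<le> card E"
proof -
  have "independent F"
    using assms by (metis norm_zero pairwise_orthogonal_independent zero_neq_one)
  thus "finite F" "card F \<le> card E"
    using independent_span_bound[OF finite_E] assms(1) span_E by auto
qed

lemma subspace_orthonormal_span:
  assumes "subspace W" "W \<subseteq> H"
  obtains F where "orthonormal_span W F"
proof -
  obtain B where B: "B \<subseteq> W" "independent B" "W \<subseteq> span B"
    using basis_exists by metis
  have "finite B"
    using independent_span_bound[OF finite_E B(2)] B(1) assms(2) span_E by auto
  moreover have "span B = W"
    using B assms(1) by (simp add: span_subspace)
  ultimately show thesis
    using orthonormal_span_exists that by blast
qed

text \<open>Minimization on the unit sphere: with the identity as constraint operator and no linear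
  term, stationarity reads \<open>F u = - 2\<mu> u\<close>, and semidefiniteness of the Hessian is
  the Rayleigh bound.\<close>

lemma rayleigh_minimum:
  assumes F: "self_adjoint_on H F" and H: "H \<noteq> {0}"
  obtains l u where "u \<in> H" "norm u = 1" "F u = l *\<^sub>R u" "\<And>w. w \<in> H \<Longrightarrow> l * (w \<bullet> w) \<le> w \<bullet> F w"
proof -
  have "self_adjoint_on H (\<lambda>u. u)" by (simp add: self_adjoint_on_def)
  from ellipsoid_minimizer[OF F this, of 0 1 1] H H_closed obtain u \<mu> where
    u: "u \<in> H" "u \<bullet> u = 1" "F u + (2 * \<mu>) *\<^sub>R u = 0"
      "\<And>w. w \<in> H \<Longrightarrow> 0 \<le> w \<bullet> (F w + (2 * \<mu>) *\<^sub>R w)"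
    by auto
  have "norm u = 1" using u(2) by (simp add: norm_eq_sqrt_inner)
  moreover have "F u = (- 2 * \<mu>) *\<^sub>R u" using u(3) by (simp add: eq_neg_iff_add_eq_0)
  moreover have "(- 2 * \<mu>) * (w \<bullet> w) \<le> w \<bullet> F w" if "w \<in> H" for w
    using u(4)[OF that] by (simp add: inner_simps)
  ultimately show thesis using that u(1) by blast
qed

lemma eigenvectors_orthogonal:
  assumes "self_adjoint_on H F" "u \<in> H" "v \<in> H" "F u = k *\<^sub>R u" "F v = l *\<^sub>R v" "k \<noteq> l"
  shows "u \<bullet> v = 0"
proof -
  have "k * (u \<bullet> v) = l * (u \<bullet> v)"
    using assms unfolding self_adjoint_on_def by (metis inner_scaleR_left inner_scaleR_right)
  thus ?thesis using assms by simp
qed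

text \<open>\<open>lambda_min_on\<close> takes \<open>Min\<close>, which is meaningful only on a
  finite set. Unit eigenvectors for distinct eigenvalues form an orthonormal family, whose size is
  bounded.\<close>

lemma finite_eigenvalues:
  assumes F: "self_adjoint_on H F"
  shows "finite (eigenvalues_on H F)"
proof -
  have "\<exists>u\<in>H. norm u = 1 \<and> F u = l *\<^sub>R u" if l: "l \<in> eigenvalues_on H F" for l
  proof -
    obtain u where u: "u \<in> H" "u \<noteq> 0" "F u = l *\<^sub>R u"
      using l by (auto simp: eigenvalues_on_def)
    hence "F (sgn u) = l *\<^sub>R sgn u"
      using F by (simp add: sgn_div_norm self_adjoint_on_def)
    moreover have "sgn u \<in> H" using u by (simp add: sgn_div_norm H_closed)
    ultimately show ?thesis using u by (intro bexI[of _ "sgn u"]) (auto simp: norm_sgn)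
  qed
  then obtain v where v: "\<And>l. l \<in> eigenvalues_on H F \<Longrightarrow> v l \<in> H \<and> norm (v l) = 1 \<and> F (v l) = l *\<^sub>R v l"
    by metis
  have orth: "v k \<bullet> v l = 0" if "k \<in> eigenvalues_on H F" "l \<in> eigenvalues_on H F" "k \<noteq> l" for k l
    using eigenvectors_orthogonal[OF F] that v by blast
  have "inj_on v (eigenvalues_on H F)"
  proof
    fix k l assume kl: "k \<in> eigenvalues_on H F" "l \<in> eigenvalues_on H F" "v k = v l"
    show "k = l" using orth[OF kl(1,2)] kl v[OF kl(1)] by (metis inner_eq_zero_iff norm_zero zero_neq_one)
  qed
  moreover have "finite (v ` eigenvalues_on H F)"
    using v orth by (intro orthonormal_card_le) (auto simp: pairwise_def orthogonal_def)
  ultimately show ?thesis using finite_imageD by blast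
qed

text \<open>Identifies \<open>Min\<close> of the spectrum with the least Rayleigh quotient: any
  eigenvalue \<open>k\<close> is bounded below by testing the Rayleigh inequality at its own
  eigenvector.\<close>

lemma lambda_min_on:
  assumes F: "self_adjoint_on H F" and H: "H \<noteq> {0}"
  obtains u where "u \<in> H" "u \<noteq> 0" "F u = lambda_min_on H F *\<^sub>R u"
    "\<And>w. w \<in> H \<Longrightarrow> lambda_min_on H F * (w \<bullet> w) \<le> w \<bullet> F w"
proof -
  obtain l u where u: "u \<in> H" "norm u = 1" "F u = l *\<^sub>R u"
      "\<And>w. w \<in> H \<Longrightarrow> l * (w \<bullet> w) \<le> w \<bullet> F w"
    using rayleigh_minimum[OF F H] by metis
  have "u \<noteq> 0" using u by auto
  have "lambda_min_on H F = l"
    unfolding lambda_min_on_def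
  proof (rule Min_eqI)
    show "l \<in> eigenvalues_on H F" using u \<open>u \<noteq> 0\<close> by (auto simp: eigenvalues_on_def)
    show "l \<le> k" if k: "k \<in> eigenvalues_on H F" for k
    proof -
      obtain w where w: "w \<in> H" "w \<noteq> 0" "F w = k *\<^sub>R w" using k by (auto simp: eigenvalues_on_def)
      hence "l * (w \<bullet> w) \<le> k * (w \<bullet> w)" using u(4)[of w] by simp
      thus ?thesis using w by simp
    qed
  qed (rule finite_eigenvalues[OF F])
  thus thesis using that u \<open>u \<noteq> 0\<close> by blast
qed

text \<open>The constant is the least eigenvalue, positive because it is attained at a nonzero
  vector.\<close>

lemma pos_def_coercive:
  assumes "pos_def_on H D"
  obtains \<delta> where "0 < \<delta>" "\<And>u. u \<in> H \<Longrightarrow> \<delta> * (u \<bullet> u) \<le> u \<bullet> D u"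
proof (cases "H = {0}")
  case True
  show thesis using that[of 1] True assms by (simp add: pos_def_on_def self_adjoint_on_def)
next
  case False
  have D: "self_adjoint_on H D" using assms by (simp add: pos_def_on_def)
  obtain l u where u: "u \<in> H" "norm u = 1" "D u = l *\<^sub>R u"
      "\<And>w. w \<in> H \<Longrightarrow> l * (w \<bullet> w) \<le> w \<bullet> D w"
    using rayleigh_minimum[OF D False] by metis
  have "u \<noteq> 0" using u by auto
  hence "0 < u \<bullet> D u" using assms u(1) by (simp add: pos_def_on_def)
  hence "0 < l" using u by (simp add: dot_square_norm)
  thus thesis using that u by blast
qed

text \<open>An orthonormal set of eigenvectors of maximal size spans, since its orthogonal complement
  is invariant and would otherwise contain a further eigenvector.\<close>

lemma orthonormal_eigenbasis:
  assumes F: "self_adjoint_on H F"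
  obtains B k where "orthonormal_span H B" "\<And>e. e \<in> B \<Longrightarrow> F e = k e *\<^sub>R e"
proof -
  define P where "P B \<longleftrightarrow> B \<subseteq> H \<and> pairwise orthogonal B \<and> (\<forall>e\<in>B. norm e = 1 \<and> (\<exists>l. F e = l *\<^sub>R e))" for B
  have "P {}" by (simp add: P_def)
  have bound: "finite B" "card B \<le> card E" if "P B" for B
    using orthonormal_card_le[of B] that by (auto simp: P_def)
  then obtain B where B: "P B" and max: "\<And>B'. P B' \<Longrightarrow> card B' \<le> card B"
    using ex_has_greatest_nat[of P "{}" card "Suc (card E)"] \<open>P {}\<close> by (metis less_Suc_eq_le)
  have BH: "B \<subseteq> H" using B by (simp add: P_def)
  define W where "W = {u \<in> H. \<forall>e\<in>B. u \<bullet> e = 0}"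
  have "subspace W"
    using subspace_H by (auto simp: W_def subspace_def inner_simps)
  then obtain W' where "orthonormal_span W W'"
    using subspace_orthonormal_span[of W] by (auto simp: W_def)
  then interpret W: orthonormal_span W W' .
  have "W = {0}"
  proof (rule ccontr)
    assume "W \<noteq> {0}"
    moreover have "self_adjoint_on W F"
    proof -
      have "F u \<in> W" if "u \<in> W" for u
      proof -
        have "F u \<bullet> e = 0" if e: "e \<in> B" for e
        proof -
          obtain l where "F e = l *\<^sub>R e" using B e by (auto simp: P_def)
          moreover have "F u \<bullet> e = u \<bullet> F e"
            using F \<open>u \<in> W\<close> e BH by (auto simp: self_adjoint_on_def W_def)
          ultimately show ?thesis using \<open>u \<in> W\<close> e by (simp add: W_def)
        qed
        thus ?thesis using F that by (auto simp: self_adjoint_on_def W_def)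
      qed
      thus ?thesis using F by (auto simp: self_adjoint_on_def W_def)
    qed
    ultimately obtain l w where w: "w \<in> W" "norm w = 1" "F w = l *\<^sub>R w"
      using W.rayleigh_minimum[of F] by metis
    have "P (insert w B)"
      using B w by (auto simp: P_def W_def pairwise_insert orthogonal_def inner_commute)
    moreover have "w \<notin> B"
      using w by (auto simp: W_def)
    ultimately show False
      using max[of "insert w B"] bound(1)[OF B] by simp
  qed
  have inner_B: "e \<bullet> e' = (if e = e' then 1 else 0)" if "e \<in> B" "e' \<in> B" for e e'
    using B that by (auto simp: P_def pairwise_def orthogonal_def dot_square_norm)
  have "span B = H"
  proof (rule subset_antisym)
    show "span B \<subseteq> H" using BH subspace_H by (rule span_minimal)
    show "H \<subseteq> span B"
    proof
      fix u assume u: "u \<in> H"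
      have "u - (\<Sum>e\<in>B. (u \<bullet> e) *\<^sub>R e) \<in> W"
        unfolding W_def using u BH bound(1)[OF B]
        by (auto simp: inner_diff_left inner_sum_left inner_B if_distrib intro!: H_closed cong: if_cong)
      hence "u = (\<Sum>e\<in>B. (u \<bullet> e) *\<^sub>R e)" using \<open>W = {0}\<close> by simp
      also have "\<dots> \<in> span B" by (intro span_sum span_scale span_base)
      finally show "u \<in> span B" .
    qed
  qed
  hence "orthonormal_span H B"
    using B bound(1)[OF B] by unfold_locales (auto simp: P_def)
  moreover have "F e = (SOME l. F e = l *\<^sub>R e) *\<^sub>R e" if "e \<in> B" for e
    using B that someI_ex[of "\<lambda>l. F e = l *\<^sub>R e"] by (auto simp: P_def)
  ultimately show thesis by (rule that)
qed

text \<open>Functional calculus in an eigenbasis: for an operator with eigenvalues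
  \<open>k e\<close>, the coefficients \<open>1 / k e\<close> give its inverse and
  \<open>sqrt (k e)\<close> its square root.\<close>

lemma diagonal_self_adjoint:
  "self_adjoint_on H (\<lambda>u. \<Sum>e\<in>E. (c e * (u \<bullet> e)) *\<^sub>R e)"
  unfolding self_adjoint_on_def
proof (intro conjI ballI allI)
  show "(\<Sum>e\<in>E. (c e * (u \<bullet> e)) *\<^sub>R e) \<in> H" for u
    using E_subset by (auto intro!: H_closed)
qed (simp_all add: inner_add_left algebra_simps sum.distrib scaleR_sum_right
      inner_sum_left inner_sum_right inner_commute mult_ac)

lemma diagonal_inner_E:
  "e \<in> E \<Longrightarrow> (\<Sum>e\<in>E. (c e * (u \<bullet> e)) *\<^sub>R e) \<bullet> e = c e * (u \<bullet> e)"
  using finite_E by (simp add: inner_sum_left inner_E if_distrib cong: if_cong)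

text \<open>Positive definiteness makes all eigenvalues nonzero, so the diagonal operator of their
  reciprocals is a right inverse; injectivity comes from \<open>u \<bullet> D u > 0\<close> for
  nonzero \<open>u\<close>.\<close>

lemma pos_def_bij:
  assumes "pos_def_on H D"
  shows "bij_betw D H H"
proof -
  have D: "self_adjoint_on H D" using assms by (simp add: pos_def_on_def)
  obtain B k where "orthonormal_span H B" and k: "\<And>e. e \<in> B \<Longrightarrow> D e = k e *\<^sub>R e"
    using orthonormal_eigenbasis[OF D] by blast
  then interpret B: orthonormal_span H B by simp
  have DH: "D u \<in> H" if "u \<in> H" for u using D that by (simp add: self_adjoint_on_def)
  have lin: "D u = (\<Sum>e\<in>B. (u \<bullet> e) *\<^sub>R D e)" if "u \<in> H" for u
    using B.linear_expand[of D u] D that by (simp add: self_adjoint_on_def)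
  have k0: "k e \<noteq> 0" if "e \<in> B" for e
  proof -
    have "e \<in> H" "e \<noteq> 0" using B.E_subset B.norm_E[OF that] that by auto
    hence "0 < e \<bullet> D e" using assms by (simp add: pos_def_on_def)
    thus ?thesis using k[OF that] by auto
  qed
  define D' where "D' u = (\<Sum>e\<in>B. (inverse (k e) * (u \<bullet> e)) *\<^sub>R e)" for u
  have D'H: "D' u \<in> H" if "u \<in> H" for u
    using B.diagonal_self_adjoint[of "\<lambda>e. inverse (k e)"] that
    by (simp add: self_adjoint_on_def flip: D'_def)
  have "D' u \<bullet> e = inverse (k e) * (u \<bullet> e)" if "e \<in> B" for u e
    unfolding D'_def using that by (rule B.diagonal_inner_E)
  moreover have cancel: "inverse (k e) * (u \<bullet> e) * k e = u \<bullet> e" if "e \<in> B" for u e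
    using k0[OF that] by simp
  ultimately have "D (D' u) = u" if "u \<in> H" for u
    using lin[OF D'H[OF that]] B.expand[OF that] k by (simp add: cancel cong: sum.cong)
  hence "H \<subseteq> D ` H"
    using D'H by (metis image_eqI subsetI)
  moreover have "inj_on D H"
  proof
    fix u v assume uv: "u \<in> H" "v \<in> H" "D u = D v"
    have "D (u + (-1) *\<^sub>R v) = D u + (-1) *\<^sub>R D v"
      using D uv H_closed unfolding self_adjoint_on_def by metis
    hence "D (u - v) = 0" using uv by simp
    thus "u = v" using assms uv H_closed unfolding pos_def_on_def by (metis eq_iff_diff_eq_0 inner_zero_right less_irrefl)
  qed
  ultimately show ?thesis using DH by (auto simp: bij_betw_def)
qed

text \<open>\<open>sqrt_on\<close> is a choice, so a witness must be exhibited: the operator with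
  the eigenvectors of \<open>D\<close> and the roots of its eigenvalues.\<close>

lemma sqrt_on:
  assumes "pos_semidef_on H D"
  shows "pos_semidef_on H (sqrt_on H D)" "u \<in> H \<Longrightarrow> sqrt_on H D (sqrt_on H D u) = D u"
proof -
  have D: "self_adjoint_on H D" using assms by (simp add: pos_semidef_on_def)
  obtain B k where "orthonormal_span H B" and k: "\<And>e. e \<in> B \<Longrightarrow> D e = k e *\<^sub>R e"
    using orthonormal_eigenbasis[OF D] by blast
  then interpret B: orthonormal_span H B by simp
  have lin: "D u = (\<Sum>e\<in>B. (u \<bullet> e) *\<^sub>R D e)" if "u \<in> H" for u
    using B.linear_expand[of D u] D that by (simp add: self_adjoint_on_def)
  have k0: "0 \<le> k e" if "e \<in> B" for e
  proof -
    have "0 \<le> e \<bullet> D e" using assms B.E_subset that by (auto simp: pos_semidef_on_def)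
    thus ?thesis using k[OF that] B.norm_E[OF that] by (simp add: dot_square_norm)
  qed
  define S where "S u = (\<Sum>e\<in>B. (sqrt (k e) * (u \<bullet> e)) *\<^sub>R e)" for u
  have S: "self_adjoint_on H S" unfolding S_def by (rule B.diagonal_self_adjoint)
  have inner_S: "S u \<bullet> e = sqrt (k e) * (u \<bullet> e)" if "e \<in> B" for u e
    unfolding S_def using that by (rule B.diagonal_inner_E)
  have "0 \<le> u \<bullet> S u" for u
    using k0 by (auto simp: S_def inner_sum_right intro!: sum_nonneg)
      (simp add: mult.assoc flip: power2_eq_square)
  moreover have "S (S u) = D u" if "u \<in> H" for u
    using k0 that by (subst lin) (auto simp: S_def[of "S u"] inner_S k intro!: sum.cong simp flip: mult.assoc)
  ultimately have "pos_semidef_on H S \<and> (\<forall>u\<in>H. S (S u) = D u)"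
    using S by (simp add: pos_semidef_on_def)
  hence *: "pos_semidef_on H (sqrt_on H D) \<and> (\<forall>u\<in>H. sqrt_on H D (sqrt_on H D u) = D u)"
    unfolding sqrt_on_def
    by (rule someI[of "\<lambda>S. pos_semidef_on H S \<and> (\<forall>u\<in>H. S (S u) = D u)"])
  thus "pos_semidef_on H (sqrt_on H D)" "u \<in> H \<Longrightarrow> sqrt_on H D (sqrt_on H D u) = D u" by auto
qed

text \<open>With \<open>S = sqrt_on H D\<close>, bijectivity of \<open>S \<circ> S = D\<close> on
  \<open>H\<close> passes to \<open>S\<close>, and self-adjointness of \<open>S\<close> passes to
  its inverse \<open>T\<close>. The third fact is \<open>T D T = 1\<close>, read as a quadratic
  form.\<close>

lemma inv_sqrt_on:
  assumes D: "pos_def_on H D"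
  shows "self_adjoint_on H (inv_sqrt_on H D)" "bij_betw (inv_sqrt_on H D) H H"
    "\<And>u. u \<in> H \<Longrightarrow> inv_sqrt_on H D u \<bullet> D (inv_sqrt_on H D u) = u \<bullet> u"
proof -
  define S where "S = sqrt_on H D"
  have "0 \<le> u \<bullet> D u" if "u \<in> H" for u
    using D that by (cases "u = 0") (auto simp: pos_def_on_def intro: less_imp_le)
  hence psd: "pos_semidef_on H D" using D by (simp add: pos_def_on_def pos_semidef_on_def)
  have S: "self_adjoint_on H S" and SS: "\<And>u. u \<in> H \<Longrightarrow> S (S u) = D u"
    using sqrt_on[OF psd] by (auto simp: S_def pos_semidef_on_def)
  have SH: "S u \<in> H" and S_sym: "v \<in> H \<Longrightarrow> S u \<bullet> v = u \<bullet> S v"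
    and S_add: "v \<in> H \<Longrightarrow> S (u + v) = S u + S v" and S_scale: "S (c *\<^sub>R u) = c *\<^sub>R S u" if "u \<in> H" for u v c
    using S that by (auto simp: self_adjoint_on_def)
  have bij: "bij_betw S H H"
    unfolding bij_betw_def
  proof
    have inj: "inj_on D H" and surj: "D ` H = H"
      using pos_def_bij[OF D] by (auto simp: bij_betw_def)
    show "inj_on S H"
      using inj SS unfolding inj_on_def by metis
    show "S ` H = H"
    proof (intro equalityI subsetI)
      fix v assume "v \<in> H"
      then obtain u where u: "u \<in> H" "D u = v" using surj by (metis imageE)
      have "S (S u) \<in> S ` H" using SH[OF u(1)] by (rule imageI)
      thus "v \<in> S ` H" using SS[OF u(1)] u(2) by metis
    qed (use SH in auto)
  qed
  define T where "T = inv_sqrt_on H D"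
  have T_eq: "T = inv_into H S" by (simp add: T_def S_def inv_sqrt_on_def)
  have TH: "T u \<in> H" and ST: "S (T u) = u" if "u \<in> H" for u
    using bij that unfolding T_eq bij_betw_def by (auto intro: inv_into_into f_inv_into_f)
  have TI: "T u = v" if "u \<in> H" "v \<in> H" "S v = u" for u v
    using bij that unfolding T_eq bij_betw_def by auto
  show "self_adjoint_on H (inv_sqrt_on H D)"
    unfolding T_def[symmetric] self_adjoint_on_def
  proof (intro conjI ballI allI)
    fix u v assume "u \<in> H" "v \<in> H"
    thus "T u \<bullet> v = u \<bullet> T v" using S_sym[of "T u" "T v"] by (simp add: TH ST)
  qed (auto intro!: TI simp: TH ST S_add S_scale H_closed)
  show "bij_betw (inv_sqrt_on H D) H H"
    unfolding T_def[symmetric] T_eq using bij by (rule bij_betw_inv_into)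
  show "inv_sqrt_on H D u \<bullet> D (inv_sqrt_on H D u) = u \<bullet> u" if "u \<in> H" for u
  proof -
    have "T u \<bullet> D (T u) = T u \<bullet> S (S (T u))" using that by (simp only: SS TH)
    also have "\<dots> = S (T u) \<bullet> S (T u)" using that by (intro S_sym[symmetric] TH SH)
    finally show ?thesis using that by (simp add: T_def[symmetric] ST)
  qed
qed

text \<open>Substituting \<open>w = D\<^sup>-\<^sup>1\<^sup>/\<^sup>2 v\<close> turns the pencil \<open>F + 2\<mu>D\<close> into \<open>D\<^sup>-\<^sup>1\<^sup>/\<^sup>2 F D\<^sup>-\<^sup>1\<^sup>/\<^sup>2 + 2\<mu>\<close>.\<close>

lemma pencil_pos_def_iff:
  assumes F: "self_adjoint_on H F" and D: "pos_def_on H D" and H: "H \<noteq> {0}"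
  defines "T \<equiv> inv_sqrt_on H D"
  defines "l \<equiv> lambda_min_on H (\<lambda>u. T (F (T u)))"
  shows "pos_def_on H (\<lambda>u. F u + (2 * \<mu>) *\<^sub>R D u) \<longleftrightarrow> - (1/2) * l < \<mu>"
proof -
  have DD: "self_adjoint_on H D" using D by (simp add: pos_def_on_def)
  have T: "self_adjoint_on H T" "bij_betw T H H" "\<And>u. u \<in> H \<Longrightarrow> T u \<bullet> D (T u) = u \<bullet> u"
    using inv_sqrt_on[OF D] by (auto simp: T_def)
  have G: "self_adjoint_on H (\<lambda>u. T (F (T u)))"
    using T(1) F unfolding self_adjoint_on_def by simp
  obtain u where u: "u \<in> H" "u \<noteq> 0" "T (F (T u)) = l *\<^sub>R u"
    and min: "\<And>w. w \<in> H \<Longrightarrow> l * (w \<bullet> w) \<le> w \<bullet> T (F (T w))"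
    using lambda_min_on[OF G H] unfolding l_def by blast
  have TG: "w \<bullet> T (F (T w)) = T w \<bullet> F (T w)" if "w \<in> H" for w
    using T(1) F that unfolding self_adjoint_on_def by metis
  have TuH: "T u \<in> H" using T(1) u by (auto simp: self_adjoint_on_def)
  have Tu: "T u \<bullet> D (T u) = u \<bullet> u" "T u \<bullet> F (T u) = l * (u \<bullet> u)"
    using T(3)[of u] TG[of u] u by auto
  have Tu0: "T u \<noteq> 0" using Tu(1) u by auto
  have sa: "self_adjoint_on H (\<lambda>u. F u + (2 * \<mu>) *\<^sub>R D u)"
    using F DD unfolding self_adjoint_on_def by (simp add: H_closed inner_simps algebra_simps)
  show "pos_def_on H (\<lambda>u. F u + (2 * \<mu>) *\<^sub>R D u) \<longleftrightarrow> - (1/2) * l < \<mu>"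
  proof
    assume "pos_def_on H (\<lambda>u. F u + (2 * \<mu>) *\<^sub>R D u)"
    \<comment> \<open>The critical test vector is \<open>T u\<close>, with \<open>u\<close> an
      eigenvector for the least eigenvalue \<open>l\<close>; the form there equals
      \<open>(l + 2 * \<mu>) * (u \<bullet> u)\<close>.\<close>
    hence "0 < T u \<bullet> (F (T u) + (2 * \<mu>) *\<^sub>R D (T u))"
      using TuH Tu0 by (simp add: pos_def_on_def)
    also have "\<dots> = (l + 2 * \<mu>) * (u \<bullet> u)" using Tu by (simp add: inner_simps algebra_simps)
    finally have "0 < l + 2 * \<mu>" using u(2) by (metis inner_gt_zero_iff zero_less_mult_pos2)
    thus "- (1/2) * l < \<mu>" by simp
  next
    assume *: "- (1/2) * l < \<mu>"
    have "0 < w \<bullet> (F w + (2 * \<mu>) *\<^sub>R D w)" if "w \<in> H" "w \<noteq> 0" for w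
    proof -
      obtain v where v: "v \<in> H" "w = T v" using T(2) \<open>w \<in> H\<close> by (auto simp: bij_betw_def)
      have "0 < w \<bullet> D w" using D that by (simp add: pos_def_on_def)
      hence "0 < v \<bullet> v" using T(3)[OF v(1)] v(2) by simp
      hence "0 < (l + 2 * \<mu>) * (v \<bullet> v)" using * by (intro mult_pos_pos) auto
      also have "\<dots> \<le> w \<bullet> (F w + (2 * \<mu>) *\<^sub>R D w)"
        using min[OF v(1)] TG[OF v(1)] T(3)[OF v(1)] v(2) by (simp add: inner_simps algebra_simps)
      finally show ?thesis .
    qed
    thus "pos_def_on H (\<lambda>u. F u + (2 * \<mu>) *\<^sub>R D u)" using sa by (simp add: pos_def_on_def)
  qed
qed

end

section \<open>Quadratic minimization on an ellipsoid\<close>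

text \<open>\<open>J\<close> and \<open>C\<close> are tied to their quadratic expressions only on
  \<open>H\<close>, so the cost and constraint of the control problem can be inserted unchanged. A
  nontrivial \<open>H\<close> guarantees that eigenvalues exist and that the endpoint is
  meaningful.\<close>

locale quadratic_program = orthonormal_span H E for H E :: "'a::real_inner set" +
  fixes F D :: "'a \<Rightarrow> 'a" and r :: 'a and g :: real and J C :: "'a \<Rightarrow> real"
  assumes F_pos: "pos_def_on H F" and D_pos: "pos_def_on H D" and r: "r \<in> H"
    and J_eq: "\<And>u. u \<in> H \<Longrightarrow> J u = 1/2 * (u \<bullet> F u) + r \<bullet> u + g"
    and C_eq: "\<And>u. u \<in> H \<Longrightarrow> C u = u \<bullet> D u"
    and nontrivial: "H \<noteq> {0}"
begin

definition primal :: "real \<Rightarrow> ereal" where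
  "primal b = (INF u\<in>{u\<in>H. C u = b}. ereal (J u))"

definition dual :: "real \<Rightarrow> ereal" where
  "dual \<mu> = (INF u\<in>H. ereal (J u + \<mu> * C u))"

definition optimal :: "real \<Rightarrow> real \<Rightarrow> bool" where
  "optimal b \<mu> \<longleftrightarrow> dual \<mu> - ereal (\<mu> * b) = (SUP \<nu>. dual \<nu> - ereal (\<nu> * b))"

definition endpoint :: real where
  "endpoint = - (1/2) * lambda_min_on H (\<lambda>u. inv_sqrt_on H D (F (inv_sqrt_on H D u)))"

lemma F_self_adjoint: "self_adjoint_on H F" and D_self_adjoint: "self_adjoint_on H D"
  using F_pos D_pos by (auto simp: pos_def_on_def)

lemma J_0: "J 0 = g" and C_0: "C 0 = 0"
  using H_closed by (simp_all add: J_eq C_eq)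

lemma D_nonneg: "u \<in> H \<Longrightarrow> 0 \<le> u \<bullet> D u" and F_nonneg: "u \<in> H \<Longrightarrow> 0 \<le> u \<bullet> F u"
  using F_pos D_pos by (cases "u = 0"; force simp: pos_def_on_def)+

lemma pencil_iff: "pos_def_on H (\<lambda>u. F u + (2 * \<mu>) *\<^sub>R D u) \<longleftrightarrow> endpoint < \<mu>"
  unfolding endpoint_def
  by (rule pencil_pos_def_iff[OF F_self_adjoint D_pos nontrivial])

lemma endpoint_neg: "endpoint < 0"
  using pencil_iff[of 0] F_pos by simp

lemma range_C: "C ` H = {0..}"
proof (intro equalityI subsetI)
  fix b :: real assume b: "b \<in> {0..}"
  obtain w where w: "w \<in> H" "w \<noteq> 0" using nontrivial H_closed by blast
  hence p: "0 < w \<bullet> D w" using D_pos by (simp add: pos_def_on_def)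
  define c where "c = sqrt (b / (w \<bullet> D w))"
  have "C (c *\<^sub>R w) = c\<^sup>2 * (w \<bullet> D w)"
    using w D_self_adjoint by (simp add: C_eq H_closed self_adjoint_on_def power2_eq_square)
  also have "\<dots> = b" using b p by (simp add: c_def)
  finally show "b \<in> C ` H" using w H_closed by blast
qed (use C_eq D_nonneg in auto)

lemma interior_range_C: "interior (C ` H) = {0<..}"
  by (simp add: range_C)

section \<open>Weak duality, bounds on the dual function, and the absence of a gap\<close>

lemma primal_le: "u \<in> H \<Longrightarrow> primal (C u) \<le> ereal (J u)"
  unfolding primal_def by (intro INF_lower) auto

lemma dual_le: "u \<in> H \<Longrightarrow> dual \<mu> \<le> ereal (J u + \<mu> * C u)"
  unfolding dual_def by (intro INF_lower)

lemma le_dual: "(\<And>u. u \<in> H \<Longrightarrow> y \<le> J u + \<mu> * C u) \<Longrightarrow> ereal y \<le> dual \<mu>"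
  unfolding dual_def by (intro INF_greatest) auto

lemma dual_not_infty: "dual \<mu> \<noteq> \<infinity>"
  using dual_le[of 0 \<mu>] H_closed by (auto simp: J_0 C_0)

lemma weak_duality: "dual \<mu> - ereal (\<mu> * b) \<le> primal b"
  unfolding primal_def
proof (rule INF_greatest)
  fix u assume u: "u \<in> {u \<in> H. C u = b}"
  hence "dual \<mu> \<le> ereal (J u + \<mu> * b)" using dual_le[of u \<mu>] by auto
  thus "dual \<mu> - ereal (\<mu> * b) \<le> ereal (J u)"
    using dual_not_infty[of \<mu>] by (cases "dual \<mu>") auto
qed

text \<open>Completing the square: \<open>\<mu>\<delta> (u \<bullet> u) + r \<bullet> u\<close> is
  at least \<open>- (r \<bullet> r) / (4\<mu>\<delta>)\<close>, and \<open>F\<close> contributes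
  nonnegatively. The loss \<open>k / \<mu>\<close> vanishes as
  \<open>\<mu> \<rightarrow> \<infinity>\<close>, which settles \<open>b \<le> 0\<close>.\<close>

lemma dual_lower_bound:
  obtains k where "0 < k" "\<And>\<mu>. 0 < \<mu> \<Longrightarrow> ereal (g - k / \<mu>) \<le> dual \<mu>"
proof -
  obtain \<delta> where \<delta>: "0 < \<delta>" "\<And>u. u \<in> H \<Longrightarrow> \<delta> * (u \<bullet> u) \<le> u \<bullet> D u"
    using pos_def_coercive[OF D_pos] by metis
  \<comment> \<open>The summand \<open>1\<close> keeps \<open>k\<close> positive when
    \<open>r = 0\<close>; later \<open>k / e\<close> serves as a positive multiplier.\<close>
  define k where "k = (r \<bullet> r) / (4 * \<delta>) + 1"
  have "0 < k" using \<delta> by (simp add: k_def add_nonneg_pos)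
  moreover have "ereal (g - k / \<mu>) \<le> dual \<mu>" if \<mu>: "0 < \<mu>" for \<mu>
  proof (rule le_dual)
    fix u assume u: "u \<in> H"
    have "0 \<le> ((2 * \<mu> * \<delta>) *\<^sub>R u + r) \<bullet> ((2 * \<mu> * \<delta>) *\<^sub>R u + r)" by simp
    also have "\<dots> = 4 * \<mu> * \<delta> * (\<mu> * (\<delta> * (u \<bullet> u)) + r \<bullet> u + (r \<bullet> r) / (4 * \<delta>) / \<mu>)"
      using \<delta> \<mu> by (simp add: inner_simps inner_commute field_simps)
    finally have "0 \<le> \<mu> * (\<delta> * (u \<bullet> u)) + r \<bullet> u + (r \<bullet> r) / (4 * \<delta>) / \<mu>"
      using mult_pos_pos[OF \<mu> \<delta>(1)] mult_le_cancel_left_pos[of "4 * \<mu> * \<delta>" 0]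
      by (metis mult.assoc mult_pos_pos mult_zero_right zero_less_numeral)
    also have "\<dots> \<le> \<mu> * (u \<bullet> D u) + r \<bullet> u + k / \<mu>"
      using \<delta>(2)[OF u] \<mu> by (intro add_mono mult_left_mono divide_right_mono) (auto simp: k_def)
    finally show "g - k / \<mu> \<le> J u + \<mu> * C u"
      using F_nonneg[OF u] by (simp add: J_eq C_eq u)
  qed
  ultimately show thesis using that by blast
qed

text \<open>One finite dual value supplies the real affine minorant that keeps \<open>primal\<close>
  above \<open>- \<infinity>\<close>.\<close>

lemma dual_1: obtains y where "dual 1 = ereal y"
proof -
  obtain k where "ereal (g - k / 1) \<le> dual 1" using dual_lower_bound by (metis zero_less_one)
  thus thesis using that dual_not_infty[of 1] by (cases "dual 1") auto
qed

lemma multiplier: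
  assumes b: "0 < b"
  obtains u \<mu> where "u \<in> H" "C u = b" "endpoint \<le> \<mu>" "primal b = ereal (J u)"
    "dual \<mu> = ereal (J u + \<mu> * b)"
proof -
  obtain \<delta> where \<delta>: "0 < \<delta>" "\<And>u. u \<in> H \<Longrightarrow> \<delta> * (u \<bullet> u) \<le> u \<bullet> D u"
    using pos_def_coercive[OF D_pos] by metis
  obtain u \<mu> where u: "u \<in> H" "u \<bullet> D u = b" "F u + r + (2 * \<mu>) *\<^sub>R D u = 0"
      "\<And>w. w \<in> H \<Longrightarrow> 0 \<le> w \<bullet> (F w + (2 * \<mu>) *\<^sub>R D w)"
    using ellipsoid_minimizer[OF F_self_adjoint D_self_adjoint r \<delta> b nontrivial] by metis
  have C_u: "C u = b" using u by (simp add: C_eq)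
  \<comment> \<open>Semidefiniteness at \<open>\<mu>\<close> becomes definiteness at every
    \<open>\<nu> > \<mu>\<close>, because \<open>2 (\<nu> - \<mu>) D\<close> is added;
    \<open>\<mu> = endpoint\<close> remains allowed.\<close>
  have "endpoint \<le> \<mu>"
  proof (rule dense_ge)
    fix \<nu> assume "\<mu> < \<nu>"
    have "0 < w \<bullet> (F w + (2 * \<nu>) *\<^sub>R D w)" if w: "w \<in> H" "w \<noteq> 0" for w
    proof -
      have "0 < 2 * (\<nu> - \<mu>) * (w \<bullet> D w)"
        using D_pos w \<open>\<mu> < \<nu>\<close> by (simp add: pos_def_on_def)
      thus ?thesis using u(4)[OF w(1)] by (simp add: inner_simps algebra_simps)
    qed
    moreover have "self_adjoint_on H (\<lambda>u. F u + (2 * \<nu>) *\<^sub>R D u)"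
      using F_self_adjoint D_self_adjoint unfolding self_adjoint_on_def
      by (simp add: H_closed inner_simps algebra_simps)
    ultimately show "endpoint \<le> \<nu>"
      using pencil_iff[of \<nu>] by (simp add: pos_def_on_def)
  qed
  moreover have "dual \<mu> = ereal (J u + \<mu> * b)"
  proof (rule antisym)
    show "dual \<mu> \<le> ereal (J u + \<mu> * b)" using dual_le[OF u(1), of \<mu>] C_u by simp
    show "ereal (J u + \<mu> * b) \<le> dual \<mu>"
    proof (rule le_dual)
      fix v assume v: "v \<in> H"
      define w where "w = v - u"
      have w: "w \<in> H" "v = u + w" using u v by (auto simp: w_def H_closed)
      \<comment> \<open>Exact second-order expansion at \<open>u\<close>: the linear term vanishes
        by stationarity and the quadratic one is nonnegative.\<close>
      have "J v + \<mu> * C v - (J u + \<mu> * b) =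
          (F u + r + (2 * \<mu>) *\<^sub>R D u) \<bullet> w + 1/2 * (w \<bullet> (F w + (2 * \<mu>) *\<^sub>R D w))"
      proof -
        have "F (u + w) = F u + F w" "D (u + w) = D u + D w" "u \<bullet> F w = w \<bullet> F u" "u \<bullet> D w = w \<bullet> D u"
          using F_self_adjoint D_self_adjoint u(1) w(1)
          unfolding self_adjoint_on_def by (simp_all add: inner_commute)
        thus ?thesis
          using u(1,2) v w by (simp add: J_eq C_eq H_closed inner_simps inner_commute algebra_simps)
      qed
      thus "J u + \<mu> * b \<le> J v + \<mu> * C v" using u(3) u(4)[OF w(1)] by simp
    qed
  qed
  moreover have "primal b = ereal (J u)"
  proof (rule antisym)
    show "primal b \<le> ereal (J u)" using primal_le[OF u(1)] C_u by simp
    \<comment> \<open>Minimality of \<open>u\<close> on the constraint set is read off from the dual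
      value by weak duality.\<close>
    show "ereal (J u) \<le> primal b"
      using weak_duality[of \<mu> b] \<open>dual \<mu> = ereal (J u + \<mu> * b)\<close> by simp
  qed
  ultimately show thesis using that u(1) C_u by blast
qed

text \<open>The identity covers every real \<open>b\<close>, also outside the attainable range,
  because closedness and convexity of \<open>primal\<close> on the whole line are read off from it.
  At \<open>b = 0\<close> only \<open>u = 0\<close> is feasible, with cost \<open>g\<close>; for
  \<open>b < 0\<close> both sides are infinite.\<close>

lemma primal_eq_SUP: "primal b = (SUP \<mu>. dual \<mu> - ereal (\<mu> * b))"
proof (rule antisym)
  show "(SUP \<mu>. dual \<mu> - ereal (\<mu> * b)) \<le> primal b"
    using weak_duality by (intro SUP_least)
  show "primal b \<le> (SUP \<mu>. dual \<mu> - ereal (\<mu> * b))"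
  proof (cases "0 < b")
    case True
    then obtain u \<mu> where "primal b = ereal (J u)" "dual \<mu> = ereal (J u + \<mu> * b)"
      using multiplier by metis
    hence "primal b = dual \<mu> - ereal (\<mu> * b)" by simp
    thus ?thesis using SUP_upper[of \<mu> UNIV "\<lambda>\<mu>. dual \<mu> - ereal (\<mu> * b)"] by simp
  next
    case False
    obtain k where k: "0 < k" "\<And>\<mu>. 0 < \<mu> \<Longrightarrow> ereal (g - k / \<mu>) \<le> dual \<mu>"
      using dual_lower_bound by metis
    have *: "ereal (g - k / \<mu> - \<mu> * b) \<le> (SUP \<mu>. dual \<mu> - ereal (\<mu> * b))" if "0 < \<mu>" for \<mu>
    proof -
      have "ereal (g - k / \<mu> - \<mu> * b) \<le> dual \<mu> - ereal (\<mu> * b)"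
        using k(2)[OF that] by (cases "dual \<mu>") auto
      also have "\<dots> \<le> (SUP \<mu>. dual \<mu> - ereal (\<mu> * b))" by (rule SUP_upper) simp
      finally show ?thesis .
    qed
    show ?thesis
    proof (cases "b = 0")
      case True
      have "primal b \<le> ereal g" using primal_le[of 0] H_closed True by (simp add: J_0 C_0)
      also have "ereal g \<le> (SUP \<mu>. dual \<mu> - ereal (\<mu> * b))"
      proof (rule ereal_le_epsilon2)
        fix e :: real assume "0 < e"
        \<comment> \<open>With the multiplier \<open>k / e\<close> the loss \<open>k / \<mu>\<close>
          is exactly \<open>e\<close>.\<close>
        thus "ereal g \<le> (SUP \<mu>. dual \<mu> - ereal (\<mu> * b)) + ereal e"
          using *[of "k / e"] k(1) True
          by (cases "SUP \<mu>. dual \<mu> - ereal (\<mu> * b)") auto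
      qed
      finally show ?thesis .
    next
      case neg: False
      hence b: "b < 0" using False by simp
      have "ereal y \<le> (SUP \<mu>. dual \<mu> - ereal (\<mu> * b))" for y
      proof -
        \<comment> \<open>\<open>\<mu> \<ge> 1\<close> keeps \<open>k / \<mu>\<close> at most
          \<open>k\<close>, and the other bound makes \<open>- \<mu> * b\<close> at least
          \<open>y - g + k\<close>; together the lower bound is at least \<open>y\<close>.\<close>
        define \<mu> where "\<mu> = max 1 ((y - g + k) / - b)"
        have "1 \<le> \<mu>" "(y - g + k) / - b \<le> \<mu>" by (auto simp: \<mu>_def)
        moreover from this have "k / \<mu> \<le> k" "y - g + k \<le> - \<mu> * b"
          using k(1) b by (auto simp: field_simps)
        ultimately have "0 < \<mu>" "y \<le> g - k / \<mu> - \<mu> * b" by linarith+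
        thus ?thesis
          by (intro order_trans[OF _ *[of \<mu>]]) simp_all
      qed
      hence "(SUP \<mu>. dual \<mu> - ereal (\<mu> * b)) = \<infinity>" by (rule ereal_top)
      thus ?thesis by simp
    qed
  qed
qed

lemma primal_finite_iff: "primal b < \<infinity> \<longleftrightarrow> b \<in> C ` H"
proof
  show "primal b < \<infinity>" if b: "b \<in> C ` H"
  proof -
    obtain u where u: "u \<in> H" "b = C u" using b by blast
    from primal_le[OF u(1)] have "primal (C u) < \<infinity>" by (rule le_less_trans) simp
    thus ?thesis using u(2) by simp
  qed
  show "b \<in> C ` H" if "primal b < \<infinity>"
  proof (rule ccontr)
    assume "b \<notin> C ` H"
    hence empty: "{u \<in> H. C u = b} = {}" by auto
    have "primal b = \<infinity>" unfolding primal_def empty by (simp add: top_ereal_def)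
    thus False using that by simp
  qed
qed

lemma primal_gt: "- \<infinity> < primal b"
proof -
  obtain y where "dual 1 = ereal y" by (rule dual_1)
  hence "ereal (y - b) \<le> primal b" using weak_duality[of 1 b] by simp
  thus ?thesis by (auto intro: less_le_trans)
qed

text \<open>The epigraph of a supremum is the intersection of the epigraphs: closed half-planes with
  normal \<open>(\<mu>, 1)\<close>, or the whole plane when
  \<open>dual \<mu> = - \<infinity>\<close>. Properness uses the finite value at
  \<open>0\<close>.\<close>

lemma proper_closed_convex_primal: "proper_closed_convex primal"
proof -
  define S where "S \<mu> = {(x, s). dual \<mu> - ereal (\<mu> * x) \<le> ereal s}" for \<mu>
  have S: "closed (S \<mu>) \<and> convex (S \<mu>)" for \<mu>
  proof (cases "dual \<mu>")
    case (real p)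
    hence eq: "S \<mu> = {z. (\<mu>, 1) \<bullet> z \<ge> p}"
      by (auto simp: S_def inner_prod_def)
    show ?thesis unfolding eq using closed_halfspace_ge convex_halfspace_ge by blast
  next
    case MInf
    hence "S \<mu> = UNIV" by (auto simp: S_def)
    thus ?thesis by simp
  qed (simp add: dual_not_infty)
  have epi: "ereal_epigraph primal = (\<Inter>\<mu>. S \<mu>)"
    by (auto simp: ereal_epigraph_def primal_eq_SUP S_def SUP_le_iff)
  show ?thesis
    unfolding proper_closed_convex_def epi
    using S primal_gt primal_finite_iff[of 0] range_C
    by (intro conjI closed_INT convex_INT) auto
qed

section \<open>Dual-optimal multipliers and the envelope formula\<close>

lemma optimal_iff: "optimal b \<mu> \<longleftrightarrow> dual \<mu> - ereal (\<mu> * b) = primal b"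
  by (simp add: optimal_def primal_eq_SUP)

text \<open>Optimality equates \<open>primal\<close>, which is never \<open>- \<infinity>\<close>,
  with an expression that is never \<open>\<infinity>\<close>, so both are real. In particular no
  multiplier is dual-optimal off the attainable range.\<close>

lemma optimal_real:
  assumes "optimal b \<mu>"
  obtains p where "dual \<mu> = ereal p" "primal b = ereal (p - \<mu> * b)"
  using assms primal_gt[of b] dual_not_infty[of \<mu>] unfolding optimal_iff
  by (cases "dual \<mu>") auto

text \<open>Each multiplier is tested at the other point; adding the two weak-duality inequalities
  leaves \<open>(\<mu>\<^sub>1 - \<mu>\<^sub>2) * (b\<^sub>2 - b\<^sub>1) \<ge> 0\<close>.\<close>

lemma optimal_antimono:
  assumes "b\<^sub>1 < b\<^sub>2" "optimal b\<^sub>1 \<mu>\<^sub>1" "optimal b\<^sub>2 \<mu>\<^sub>2"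
  shows "\<mu>\<^sub>2 \<le> \<mu>\<^sub>1"
proof -
  obtain p\<^sub>1 where p1: "dual \<mu>\<^sub>1 = ereal p\<^sub>1" "primal b\<^sub>1 = ereal (p\<^sub>1 - \<mu>\<^sub>1 * b\<^sub>1)"
    using optimal_real[OF assms(2)] by blast
  obtain p\<^sub>2 where p2: "dual \<mu>\<^sub>2 = ereal p\<^sub>2" "primal b\<^sub>2 = ereal (p\<^sub>2 - \<mu>\<^sub>2 * b\<^sub>2)"
    using optimal_real[OF assms(3)] by blast
  have "p\<^sub>2 - \<mu>\<^sub>2 * b\<^sub>1 \<le> p\<^sub>1 - \<mu>\<^sub>1 * b\<^sub>1" "p\<^sub>1 - \<mu>\<^sub>1 * b\<^sub>2 \<le> p\<^sub>2 - \<mu>\<^sub>2 * b\<^sub>2"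
    using weak_duality[of \<mu>\<^sub>2 b\<^sub>1] weak_duality[of \<mu>\<^sub>1 b\<^sub>2] p1 p2 by simp_all
  hence "0 \<le> (\<mu>\<^sub>1 - \<mu>\<^sub>2) * (b\<^sub>2 - b\<^sub>1)" by (simp add: algebra_simps)
  thus ?thesis using assms(1) by (simp add: zero_le_mult_iff)
qed

text \<open>By weak duality \<open>primal c + \<mu> * c\<close> is at least
  \<open>dual \<mu>\<close>, with equality at \<open>c = b\<close>, so its derivative vanishes
  there.\<close>

lemma envelope:
  assumes b: "0 < b" and v: "((\<lambda>c. real_of_ereal (primal c)) has_real_derivative v) (at b)"
    and \<mu>: "optimal b \<mu>"
  shows "v = - \<mu>"
proof -
  obtain p where p: "dual \<mu> = ereal p" "primal b = ereal (p - \<mu> * b)"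
    using optimal_real[OF \<mu>] by blast
  let ?h = "\<lambda>c. real_of_ereal (primal c) + \<mu> * c"
  have "(?h has_real_derivative v + \<mu>) (at b)"
    using v by (auto intro!: derivative_eq_intros)
  \<comment> \<open>The radius \<open>b\<close> keeps \<open>c > 0\<close>, where
    \<open>primal c\<close> is finite; at an infinite value \<open>real_of_ereal\<close> would
    return the default \<open>0\<close>, which could break the comparison.\<close>
  moreover have "?h b \<le> ?h c" if "\<bar>b - c\<bar> < b" for c
  proof -
    have "primal c < \<infinity>" unfolding primal_finite_iff range_C using that by auto
    thus ?thesis
      using weak_duality[of \<mu> c] primal_gt[of c] p by (cases "primal c") auto
  qed
  ultimately have "v + \<mu> = 0"
    using b DERIV_local_min by blast
  thus ?thesis by simp
qed

text \<open>The constant passes through the infimum. Since the infimum may be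
  \<open>- \<infinity>\<close>, one inequality is proved with \<open>\<mu> * b\<close> added and
  then rearranged.\<close>

lemma lagrangian_INF:
  "(INF u\<in>H. ereal (J u + \<mu> * (C u - b))) = dual \<mu> - ereal (\<mu> * b)"
  (is "?I = _")
proof (rule antisym)
  have "?I + ereal (\<mu> * b) \<le> dual \<mu>"
    unfolding dual_def
  proof (rule INF_greatest)
    fix u assume "u \<in> H"
    hence "?I \<le> ereal (J u + \<mu> * (C u - b))" by (rule INF_lower)
    thus "?I + ereal (\<mu> * b) \<le> ereal (J u + \<mu> * C u)"
      by (cases ?I) (auto simp: algebra_simps)
  qed
  thus "?I \<le> dual \<mu> - ereal (\<mu> * b)" by (simp add: ereal_le_minus)
  show "dual \<mu> - ereal (\<mu> * b) \<le> ?I"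
  proof (rule INF_greatest)
    fix u assume "u \<in> H"
    thus "dual \<mu> - ereal (\<mu> * b) \<le> ereal (J u + \<mu> * (C u - b))"
      using dual_le[of u \<mu>] by (cases "dual \<mu>") (auto simp: algebra_simps)
  qed
qed

lemma strong_duality:
  assumes b: "0 < b"
  shows "\<exists>\<mu>\<in>{endpoint..}. \<exists>u\<in>H. optimal b \<mu> \<and> C u = b \<and> primal b = ereal (J u) \<and>
    ereal (J u) = dual \<mu> - ereal (\<mu> * b) \<and>
    is_max (\<lambda>\<mu>. dual \<mu> - ereal (\<mu> * b)) {endpoint..} (primal b) \<and>
    is_max (\<lambda>\<mu>. INF u\<in>H. ereal (J u + \<mu> * (C u - b))) UNIV (primal b)"
proof -
  obtain u \<mu> where u: "u \<in> H" "C u = b" "endpoint \<le> \<mu>" "primal b = ereal (J u)"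
      "dual \<mu> = ereal (J u + \<mu> * b)"
    using multiplier[OF b] by metis
  hence eq: "dual \<mu> - ereal (\<mu> * b) = primal b" by simp
  have "is_max (\<lambda>\<mu>. dual \<mu> - ereal (\<mu> * b)) S (primal b)" if "\<mu> \<in> S" for S
    using eq weak_duality that by (auto simp: is_max_def)
  thus ?thesis
    unfolding lagrangian_INF optimal_iff using u eq
    by (intro bexI[of _ \<mu>] bexI[of _ u] conjI) simp_all
qed

end

section \<open>Linear differential equations with measurable coefficients\<close>

lemma norm_matrix_vector_mult_le: "norm (A *v x) \<le> norm A * norm x" for A :: "real^'n^'m"
proof -
  have "norm (A *v x) \<le> L2_set (\<lambda>i. norm (A $ i) * norm x) UNIV"
    unfolding norm_vec_def[of "A *v x"]
    by (intro L2_set_mono) (simp_all add: matrix_vector_mul_component Cauchy_Schwarz_ineq2)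
  also have "\<dots> = norm A * norm x"
    by (simp add: norm_vec_def[of A] L2_set_left_distrib)
  finally show ?thesis .
qed

lemma bounded_bilinear_matrix_vector_mult:
  "bounded_bilinear ((*v) :: real^'n^'m \<Rightarrow> real^'n \<Rightarrow> real^'m)"
proof
  show "\<exists>K. \<forall>(A :: real^'n^'m) x. norm (A *v x) \<le> norm A * norm x * K"
    by (intro exI[of _ 1]) (simp add: norm_matrix_vector_mult_le)
qed (simp_all add: algebra_simps scaleR_matrix_vector_assoc[symmetric])

lemma borel_measurable_matrix_vector_mult [measurable]:
  fixes A :: "'a \<Rightarrow> real^'n^'m"
  assumes "A \<in> borel_measurable M" "f \<in> borel_measurable M"
  shows "(\<lambda>t. A t *v f t) \<in> borel_measurable M"
  using assms
  by (rule borel_measurable_continuous_Pair)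
    (intro bounded_bilinear.continuous_on[OF bounded_bilinear_matrix_vector_mult] continuous_intros)

lemma integrable_lebesgue_on_subset:
  fixes f :: "real \<Rightarrow> 'a::euclidean_space"
  assumes "integrable (lebesgue_on {0..T}) f" "t \<le> T"
  shows "integrable (lebesgue_on {0..t}) f"
  using set_integrable_subset[of lebesgue "{0..T}" f "{0..t}"] assms
  by (simp add: set_integrable_def integrable_restrict_space)

lemma AE_lebesgue_on_subset:
  assumes "AE s in lebesgue_on {0..T}. Q s" "t \<le> (T::real)"
  shows "AE s in lebesgue_on {0..t}. Q s"
  using assms by (auto simp: AE_restrict_space_iff elim!: eventually_mono)

lemma continuous_on_lebesgue_primitive:
  fixes f :: "real \<Rightarrow> 'a::euclidean_space"
  assumes "integrable (lebesgue_on {0..T}) f"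
  shows "continuous_on {0..T} (\<lambda>t. LINT s|lebesgue_on {0..t}. f s)"
proof -
  have "(LINT s|lebesgue_on {0..t}. f s) = integral {0..t} f" if "t \<in> {0..T}" for t
    using that by (intro lebesgue_integral_eq_integral integrable_lebesgue_on_subset[OF assms]) auto
  moreover have "continuous_on {0..T} (\<lambda>t. integral {0..t} f)"
    using assms by (intro indefinite_integral_continuous_1 integrable_on_lebesgue_on) auto
  ultimately show ?thesis by (metis (no_types, lifting) continuous_on_cong)
qed

lemma lebesgue_on_integral_power:
  assumes "0 \<le> t"
  shows "integrable (lebesgue_on {0..t}) (\<lambda>s. s ^ k)"
    and "(LINT s|lebesgue_on {0..t}. s ^ k) = t ^ Suc k / real (Suc k)"
proof -
  show *: "integrable (lebesgue_on {0..t}) (\<lambda>s. s ^ k)"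
    by (intro continuous_imp_integrable_real continuous_intros)
  have "((\<lambda>s. s ^ k) has_integral (t ^ Suc k / real (Suc k) - 0 ^ Suc k / real (Suc k))) {0..t}"
  proof (rule fundamental_theorem_of_calculus[OF assms])
    fix s assume "s \<in> {0..t}"
    have "((\<lambda>s. s ^ Suc k / real (Suc k)) has_real_derivative s ^ k) (at s within {0..t})"
      by (rule derivative_eq_intros refl | simp)+
    thus "((\<lambda>s. s ^ Suc k / real (Suc k)) has_vector_derivative s ^ k) (at s within {0..t})"
      by (simp add: has_real_derivative_iff_has_vector_derivative)
  qed
  thus "(LINT s|lebesgue_on {0..t}. s ^ k) = t ^ Suc k / real (Suc k)"
    using lebesgue_integral_eq_integral[OF *] by (simp add: integral_unique)
qed

locale linear_ode =
  fixes T K :: real and A :: "real \<Rightarrow> real^'n^'n"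
  assumes A_measurable: "A \<in> borel_measurable (lebesgue_on {0..T})"
    and A_bound: "AE s in lebesgue_on {0..T}. norm (A s) \<le> K"
    and K: "0 \<le> K"
begin

definition solution :: "real^'n \<Rightarrow> (real \<Rightarrow> real^'n) \<Rightarrow> (real \<Rightarrow> real^'n) \<Rightarrow> bool" where
  "solution x\<^sub>0 g x \<longleftrightarrow> integrable (lebesgue_on {0..T}) (\<lambda>s. A s *v x s + g s) \<and>
     (\<forall>t\<in>{0..T}. x t = x\<^sub>0 + (LINT s|lebesgue_on {0..t}. A s *v x s + g s))"

text \<open>Integrating \<open>K * C * (K * s) ^ k / fact k\<close> from \<open>0\<close> to
  \<open>t\<close> gives the next term of the exponential series. The integral of the norm is
  controlled, and not only the norm of the integral, because termwise integration of the series asks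
  for it.\<close>

lemma
  assumes z: "continuous_on {0..T} z" and t: "t \<in> {0..T}"
    and bound: "\<And>s. s \<in> {0..T} \<Longrightarrow> norm (z s) \<le> C * ((K * s) ^ k / fact k)"
  shows integrable_iterate: "integrable (lebesgue_on {0..t}) (\<lambda>s. A s *v z s)"
    and integral_norm_iterate:
      "(LINT s|lebesgue_on {0..t}. norm (A s *v z s)) \<le> C * ((K * t) ^ Suc k / fact (Suc k))"
proof -
  let ?b = "\<lambda>s. K * C * K ^ k / fact k * s ^ k"
  have "(\<lambda>s. A s *v z s) \<in> borel_measurable (lebesgue_on {0..T})"
    using A_measurable z
    by (intro borel_measurable_matrix_vector_mult)
      (auto intro: continuous_imp_measurable_on_sets_lebesgue)
  hence meas: "(\<lambda>s. A s *v z s) \<in> borel_measurable (lebesgue_on {0..t})"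
    by (rule measurable_restrict_mono) (use t in auto)
  have int_b: "integrable (lebesgue_on {0..t}) ?b"
    using t lebesgue_on_integral_power(1)[of t k] by simp
  have ae: "AE s in lebesgue_on {0..t}. norm (A s *v z s) \<le> ?b s"
  proof -
    have "AE s in lebesgue_on {0..t}. norm (A s) \<le> K"
      using AE_lebesgue_on_subset[OF A_bound] t by simp
    thus ?thesis
      using AE_space
    proof eventually_elim
      case (elim s)
      have "norm (A s *v z s) \<le> norm (A s) * norm (z s)" by (rule norm_matrix_vector_mult_le)
      also have "\<dots> \<le> K * (C * ((K * s) ^ k / fact k))"
        using elim t K bound[of s] by (intro mult_mono) auto
      finally show ?case by (simp add: power_mult_distrib mult_ac)
    qed
  qed
  show int: "integrable (lebesgue_on {0..t}) (\<lambda>s. A s *v z s)"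
    using int_b meas
  proof (rule Bochner_Integration.integrable_bound)
    show "AE s in lebesgue_on {0..t}. norm (A s *v z s) \<le> norm (?b s)"
      using ae by eventually_elim (metis abs_ge_self order_trans real_norm_def)
  qed
  have "(LINT s|lebesgue_on {0..t}. norm (A s *v z s)) \<le> (LINT s|lebesgue_on {0..t}. ?b s)"
    using int int_b ae by (intro integral_mono_AE) auto
  also have "\<dots> = K * C * K ^ k / fact k * (t ^ Suc k / real (Suc k))"
    using t lebesgue_on_integral_power(2)[of t k] by simp
  also have "\<dots> = C * ((K * t) ^ Suc k / fact (Suc k))"
    by (simp add: power_mult_distrib field_simps)
  finally show "(LINT s|lebesgue_on {0..t}. norm (A s *v z s)) \<le> C * ((K * t) ^ Suc k / fact (Suc k))" .
qed

lemma norm_iterate: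
  assumes "continuous_on {0..T} z" "t \<in> {0..T}"
    and "\<And>s. s \<in> {0..T} \<Longrightarrow> norm (z s) \<le> C * ((K * s) ^ k / fact k)"
  shows "norm (LINT s|lebesgue_on {0..t}. A s *v z s) \<le> C * ((K * t) ^ Suc k / fact (Suc k))"
  using integral_norm_bound integral_norm_iterate[OF assms] by (rule order_trans)

lemma summable_majorant: "summable (\<lambda>k. C * ((K * t) ^ k / fact k))"
  using summable_exp_generic[of "K * t"] by (intro summable_mult) (simp add: divide_inverse mult.commute)

lemma continuous_bounded:
  fixes z :: "real \<Rightarrow> real^'n"
  assumes "continuous_on {0..T} z"
  obtains C where "\<And>s. s \<in> {0..T} \<Longrightarrow> norm (z s) \<le> C"
proof -
  have "bounded (z ` {0..T})"
    using assms compact_continuous_image compact_imp_bounded by blast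
  thus thesis using that unfolding bounded_iff by blast
qed

lemma solution_continuous:
  assumes "solution x\<^sub>0 g x"
  shows "continuous_on {0..T} x"
proof -
  have "continuous_on {0..T} (\<lambda>t. x\<^sub>0 + (LINT s|lebesgue_on {0..t}. A s *v x s + g s))"
    using assms by (intro continuous_on_add continuous_on_const continuous_on_lebesgue_primitive)
      (simp add: solution_def)
  thus ?thesis by (rule continuous_on_eq) (use assms in \<open>simp add: solution_def\<close>)
qed

lemma integrable_coefficient:
  assumes "continuous_on {0..T} x"
  shows "integrable (lebesgue_on {0..T}) (\<lambda>s. A s *v x s)"
proof (cases "0 \<le> T")
  case True
  obtain C where "\<And>s. s \<in> {0..T} \<Longrightarrow> norm (x s) \<le> C" using continuous_bounded[OF assms] by blast
  thus ?thesis using integrable_iterate[OF assms, of T C 0] True by simp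
qed simp

text \<open>The difference \<open>w\<close> of two solutions is its own image under the integral
  operator, so the Picard estimate applies for every \<open>k\<close>, and its bound tends to
  \<open>0\<close>.\<close>

lemma solution_unique:
  assumes "solution x\<^sub>0 g x" "solution x\<^sub>0 g y" "t \<in> {0..T}"
  shows "x t = y t"
proof -
  define w where "w t = x t - y t" for t
  have cont: "continuous_on {0..T} w"
    unfolding w_def using assms solution_continuous by (intro continuous_on_diff) auto
  then obtain C where C: "\<And>s. s \<in> {0..T} \<Longrightarrow> norm (w s) \<le> C" using continuous_bounded by blast
  have w_eq: "w t = (LINT s|lebesgue_on {0..t}. A s *v w s)" if "t \<in> {0..T}" for t
  proof -
    have "integrable (lebesgue_on {0..t}) (\<lambda>s. A s *v x s + g s)"
      "integrable (lebesgue_on {0..t}) (\<lambda>s. A s *v y s + g s)"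
      using assms that by (auto simp: solution_def intro: integrable_lebesgue_on_subset)
    from Bochner_Integration.integral_diff[OF this] show ?thesis
      using assms(1,2) that by (simp add: solution_def w_def matrix_vector_mult_diff_distrib)
  qed
  have "norm (w s) \<le> C * ((K * s) ^ k / fact k)" if "s \<in> {0..T}" for s k
    using that
  proof (induction k arbitrary: s)
    case (Suc k)
    thus ?case using norm_iterate[OF cont _ Suc.IH, of s] w_eq[of s] by simp
  qed (use C in simp)
  hence "norm (w t) \<le> 0"
    using assms(3) by (intro LIMSEQ_le_const[OF summable_LIMSEQ_zero[OF summable_majorant[of C t]]]) auto
  thus ?thesis by (simp add: w_def)
qed

text \<open>Not the Picard iterates but their successive differences, i.e. the terms of the Neumann
  series; the solution is their sum.\<close>

primrec picard :: "real^'n \<Rightarrow> (real \<Rightarrow> real^'n) \<Rightarrow> nat \<Rightarrow> real \<Rightarrow> real^'n" where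
  "picard x\<^sub>0 g 0 t = x\<^sub>0 + (LINT s|lebesgue_on {0..t}. g s)"
| "picard x\<^sub>0 g (Suc k) t = (LINT s|lebesgue_on {0..t}. A s *v picard x\<^sub>0 g k s)"

lemma solution_exists:
  assumes g: "integrable (lebesgue_on {0..T}) g"
  shows "\<exists>x. solution x\<^sub>0 g x"
proof -
  define z where "z = picard x\<^sub>0 g"
  have z_0: "z 0 t = x\<^sub>0 + (LINT s|lebesgue_on {0..t}. g s)" for t
    by (simp add: z_def)
  have z_Suc: "z (Suc k) t = (LINT s|lebesgue_on {0..t}. A s *v z k s)" for k t
    by (simp add: z_def)
  have cont_0: "continuous_on {0..T} (z 0)"
    unfolding z_0 using g by (intro continuous_on_add continuous_on_const continuous_on_lebesgue_primitive)
  then obtain C where C: "\<And>s. s \<in> {0..T} \<Longrightarrow> norm (z 0 s) \<le> C" using continuous_bounded by blast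
  have z: "continuous_on {0..T} (z k) \<and> (\<forall>s\<in>{0..T}. norm (z k s) \<le> C * ((K * s) ^ k / fact k))" for k
  proof (induction k)
    case (Suc k)
    have "continuous_on {0..T} (z (Suc k))"
      unfolding z_Suc using Suc by (intro continuous_on_lebesgue_primitive integrable_coefficient) auto
    moreover have "norm (z (Suc k) s) \<le> C * ((K * s) ^ Suc k / fact (Suc k))" if "s \<in> {0..T}" for s
      unfolding z_Suc using Suc that by (intro norm_iterate) auto
    ultimately show ?case by blast
  qed (use C cont_0 in simp)
  hence cont: "continuous_on {0..T} (z k)"
    and bound: "s \<in> {0..T} \<Longrightarrow> norm (z k s) \<le> C * ((K * s) ^ k / fact k)" for k s by auto
  define x where "x t = (\<Sum>k. z k t)" for t
  have sum_z: "summable (\<lambda>k. norm (z k t))" if "t \<in> {0..T}" for t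
    using bound[OF that] by (intro summable_comparison_test'[OF summable_majorant[of C t], of 0]) auto
  have A_x: "(\<lambda>k. A s *v z k s) sums (A s *v x s)" "summable (\<lambda>k. norm (A s *v z k s))"
    if "s \<in> {0..T}" for s
  proof -
    have "(\<lambda>k. z k s) sums x s"
      unfolding x_def using summable_norm_cancel[OF sum_z[OF that]] by (rule summable_sums)
    thus "(\<lambda>k. A s *v z k s) sums (A s *v x s)"
      by (rule bounded_linear.sums[OF matrix_vector_mul_bounded_linear])
    show "summable (\<lambda>k. norm (A s *v z k s))"
      by (rule summable_comparison_test'[OF summable_mult[OF sum_z[OF that], of "norm (A s)"], of 0])
        (simp add: norm_matrix_vector_mult_le)
  qed
  have int_x: "integrable (lebesgue_on {0..t}) (\<lambda>s. A s *v x s)"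
    and sums_x: "(\<lambda>k. z (Suc k) t) sums (LINT s|lebesgue_on {0..t}. A s *v x s)" if t: "t \<in> {0..T}" for t
  proof -
    \<comment> \<open>Facts \<open>1\<close>, \<open>2\<close> and \<open>3\<close> are the
      conditions for exchanging sum and integral; the factorial majorant supplies the two
      summability conditions.\<close>
    have 1: "integrable (lebesgue_on {0..t}) (\<lambda>s. A s *v z k s)" for k
      using integrable_iterate[OF cont t bound] .
    have 2: "AE s in lebesgue_on {0..t}. summable (\<lambda>k. norm (A s *v z k s))"
      using t by (intro AE_I2) (auto intro!: A_x(2))
    have 3: "summable (\<lambda>k. LINT s|lebesgue_on {0..t}. norm (A s *v z k s))"
    proof (rule summable_comparison_test'[of _ 0])
      show "summable (\<lambda>k. C * ((K * t) ^ Suc k / fact (Suc k)))"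
        using summable_majorant[of C t] by (subst summable_Suc_iff)
      show "norm (LINT s|lebesgue_on {0..t}. norm (A s *v z k s)) \<le> C * ((K * t) ^ Suc k / fact (Suc k))" for k
        using integral_norm_iterate[OF cont t bound, of k] by simp
    qed
    have eq: "(\<Sum>k. A s *v z k s) = A s *v x s" if "s \<in> space (lebesgue_on {0..t})" for s
      using that t by (intro sums_unique[symmetric] A_x(1)) auto
    show "integrable (lebesgue_on {0..t}) (\<lambda>s. A s *v x s)"
      using integrable_suminf[OF 1 2 3]
        Bochner_Integration.integrable_cong[OF refl eq, where M = "lebesgue_on {0..t}"] by fast
    show "(\<lambda>k. z (Suc k) t) sums (LINT s|lebesgue_on {0..t}. A s *v x s)"
      using sums_integral[OF 1 2 3]
        Bochner_Integration.integral_cong[OF refl eq, where M = "lebesgue_on {0..t}"] by (simp only: z_Suc)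
  qed
  have "solution x\<^sub>0 g x"
    unfolding solution_def
  proof (intro conjI ballI)
    show "integrable (lebesgue_on {0..T}) (\<lambda>s. A s *v x s + g s)"
    proof (cases "0 \<le> T")
      case True
      thus ?thesis using int_x[of T] g by (intro Bochner_Integration.integrable_add) auto
    qed simp
    fix t assume t: "t \<in> {0..T}"
    \<comment> \<open>The head \<open>z 0\<close> carries the initial value and the forcing, while
      the tail sums to the integral of \<open>A x\<close>.\<close>
    have "x t = z 0 t + (\<Sum>k. z (Suc k) t)"
      unfolding x_def using suminf_split_head[OF summable_norm_cancel[OF sum_z[OF t]]] by simp
    also have "(\<Sum>k. z (Suc k) t) = (LINT s|lebesgue_on {0..t}. A s *v x s)"
      using sums_x[OF t] by (rule sums_unique[symmetric])
    also have "z 0 t + \<dots> = x\<^sub>0 + (LINT s|lebesgue_on {0..t}. A s *v x s + g s)"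
      using int_x[OF t] integrable_lebesgue_on_subset[OF g, of t] t by (simp add: z_0)
    finally show "x t = x\<^sub>0 + (LINT s|lebesgue_on {0..t}. A s *v x s + g s)" .
  qed
  thus ?thesis by blast
qed

text \<open>The same choice as in \<open>lq_state\<close>, so that the two agree after
  unfolding.\<close>

definition sol :: "real^'n \<Rightarrow> (real \<Rightarrow> real^'n) \<Rightarrow> real \<Rightarrow> real^'n" where
  "sol x\<^sub>0 g = (SOME x. solution x\<^sub>0 g x)"

lemma solution_sol: "integrable (lebesgue_on {0..T}) g \<Longrightarrow> solution x\<^sub>0 g (sol x\<^sub>0 g)"
  unfolding sol_def using solution_exists by (rule someI_ex)

lemma sol_continuous: "integrable (lebesgue_on {0..T}) g \<Longrightarrow> continuous_on {0..T} (sol x\<^sub>0 g)"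
  using solution_sol solution_continuous by blast

text \<open>\<open>f\<close> equals the combination only almost everywhere, since chosen
  representatives of square-integrable classes respect linear combinations only up to null
  sets.\<close>

lemma solution_combine:
  assumes x: "solution x\<^sub>0 g x" and y: "solution y\<^sub>0 h y"
    and f: "f \<in> borel_measurable (lebesgue_on {0..T})"
      "AE s in lebesgue_on {0..T}. f s = a *\<^sub>R g s + b *\<^sub>R h s"
  shows "solution (a *\<^sub>R x\<^sub>0 + b *\<^sub>R y\<^sub>0) f (\<lambda>t. a *\<^sub>R x t + b *\<^sub>R y t)"
proof -
  let ?w = "\<lambda>s. a *\<^sub>R x s + b *\<^sub>R y s"
  let ?F = "\<lambda>s. a *\<^sub>R (A s *v x s + g s) + b *\<^sub>R (A s *v y s + h s)"
  have F: "integrable (lebesgue_on {0..T}) ?F"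
    using x y by (auto simp: solution_def)
  have "continuous_on {0..T} ?w"
    using x y solution_continuous by (intro continuous_intros) auto
  hence "(\<lambda>s. A s *v ?w s) \<in> borel_measurable (lebesgue_on {0..T})"
    by (rule borel_measurable_integrable[OF integrable_coefficient])
  hence meas: "(\<lambda>s. A s *v ?w s + f s) \<in> borel_measurable (lebesgue_on {0..T})"
    using f(1) by (rule borel_measurable_add)
  have ae: "AE s in lebesgue_on {0..T}. A s *v ?w s + f s = ?F s"
    using f(2) by eventually_elim (simp add: algebra_simps)
  show ?thesis
    unfolding solution_def
  proof (intro conjI ballI)
    show "integrable (lebesgue_on {0..T}) (\<lambda>s. A s *v ?w s + f s)"
      using F by (subst integrable_cong_AE[OF meas _ ae]) auto
    fix t assume t: "t \<in> {0..T}"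
    have int: "integrable (lebesgue_on {0..t}) (\<lambda>s. A s *v x s + g s)"
      "integrable (lebesgue_on {0..t}) (\<lambda>s. A s *v y s + h s)"
      using x y t by (auto simp: solution_def intro: integrable_lebesgue_on_subset)
    have "(LINT s|lebesgue_on {0..t}. A s *v ?w s + f s) = (LINT s|lebesgue_on {0..t}. ?F s)"
    proof (rule integral_cong_AE)
      show "(\<lambda>s. A s *v ?w s + f s) \<in> borel_measurable (lebesgue_on {0..t})"
        using meas by (rule measurable_restrict_mono) (use t in auto)
      show "?F \<in> borel_measurable (lebesgue_on {0..t})"
        using int by auto
      show "AE s in lebesgue_on {0..t}. A s *v ?w s + f s = ?F s"
        using AE_lebesgue_on_subset[OF ae] t by simp
    qed
    also have "\<dots> = a *\<^sub>R (LINT s|lebesgue_on {0..t}. A s *v x s + g s)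
        + b *\<^sub>R (LINT s|lebesgue_on {0..t}. A s *v y s + h s)"
      using int by (subst Bochner_Integration.integral_add) auto
    finally show "?w t = a *\<^sub>R x\<^sub>0 + b *\<^sub>R y\<^sub>0 + (LINT s|lebesgue_on {0..t}. A s *v ?w s + f s)"
      using x y t by (simp add: solution_def scaleR_add_right)
  qed
qed

lemma sol_combine:
  assumes "integrable (lebesgue_on {0..T}) g" "integrable (lebesgue_on {0..T}) h"
    and "f \<in> borel_measurable (lebesgue_on {0..T})"
      "AE s in lebesgue_on {0..T}. f s = a *\<^sub>R g s + b *\<^sub>R h s"
    and "t \<in> {0..T}"
  shows "sol (a *\<^sub>R x\<^sub>0 + b *\<^sub>R y\<^sub>0) f t = a *\<^sub>R sol x\<^sub>0 g t + b *\<^sub>R sol y\<^sub>0 h t"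
proof -
  have "integrable (lebesgue_on {0..T}) f"
    using assms(1,2) by (subst integrable_cong_AE[OF assms(3) _ assms(4)]) auto
  thus ?thesis
    using solution_combine[OF solution_sol[OF assms(1)] solution_sol[OF assms(2)] assms(3,4)] assms(5)
    by (intro solution_unique[OF solution_sol])
qed

end

section \<open>The linear-quadratic cost as a quadratic form\<close>

definition sq_int :: "'a measure \<Rightarrow> ('a \<Rightarrow> 'b::euclidean_space) \<Rightarrow> bool" where
  "sq_int M f \<longleftrightarrow> f \<in> borel_measurable M \<and> integrable M (\<lambda>t. (norm (f t))\<^sup>2)"

lemma sq_int_measurable: "sq_int M f \<Longrightarrow> f \<in> borel_measurable M"
  by (simp add: sq_int_def)

lemma sq_int_bound:
  assumes "sq_int M g" "f \<in> borel_measurable M" "AE t in M. norm (f t) \<le> c * norm (g t)"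
  shows "sq_int M f"
  unfolding sq_int_def
proof
  show "integrable M (\<lambda>t. (norm (f t))\<^sup>2)"
  proof (rule Bochner_Integration.integrable_bound)
    show "integrable M (\<lambda>t. c\<^sup>2 * (norm (g t))\<^sup>2)" using assms(1) by (simp add: sq_int_def)
    show "AE t in M. norm ((norm (f t))\<^sup>2) \<le> norm (c\<^sup>2 * (norm (g t))\<^sup>2)"
      using assms(3)
    proof eventually_elim
      case (elim t)
      hence "(norm (f t))\<^sup>2 \<le> (c * norm (g t))\<^sup>2" by (intro power_mono) auto
      thus ?case by (simp add: power_mult_distrib)
    qed
  qed (use assms(2) in measurable)
qed (rule assms)

lemma integrable_inner_sq_int:
  assumes "sq_int M f" "sq_int M g"
  shows "integrable M (\<lambda>t. f t \<bullet> g t)"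
proof (rule Bochner_Integration.integrable_bound)
  show "integrable M (\<lambda>t. (norm (f t))\<^sup>2 + (norm (g t))\<^sup>2)"
    using assms by (simp add: sq_int_def)
  show "(\<lambda>t. f t \<bullet> g t) \<in> borel_measurable M"
    using assms by (auto simp: sq_int_def)
  have "\<bar>f t \<bullet> g t\<bar> \<le> (norm (f t))\<^sup>2 + (norm (g t))\<^sup>2" for t
    using Cauchy_Schwarz_ineq2[of "f t" "g t"] sum_squares_bound[of "norm (f t)" "norm (g t)"]
      mult_nonneg_nonneg[OF norm_ge_zero norm_ge_zero, of "f t" "g t"] by linarith
  thus "AE t in M. norm (f t \<bullet> g t) \<le> norm ((norm (f t))\<^sup>2 + (norm (g t))\<^sup>2)"
    by simp
qed

lemma sq_int_bounded:
  assumes "finite_measure M" "f \<in> borel_measurable M" "AE t in M. norm (f t) \<le> c"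
  shows "sq_int M f"
proof -
  interpret finite_measure M by fact
  have "sq_int M (\<lambda>t. 1::real)" by (simp add: sq_int_def)
  thus ?thesis by (rule sq_int_bound[of _ _ _ c]) (use assms in auto)
qed

lemma integrable_sq_int:
  assumes "finite_measure M" "sq_int M f"
  shows "integrable M f"
proof (rule Bochner_Integration.integrable_bound)
  interpret finite_measure M by fact
  show "integrable M (\<lambda>t. 1 + (norm (f t))\<^sup>2)" using assms by (simp add: sq_int_def)
  have "norm (f t) \<le> 1 + (norm (f t))\<^sup>2" for t
    using sum_squares_bound[of 1 "norm (f t)"] norm_ge_zero[of "f t"] by (simp del: norm_ge_zero)
  thus "AE t in M. norm (f t) \<le> norm (1 + (norm (f t))\<^sup>2)" by (simp add: abs_of_nonneg add_nonneg_nonneg)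
qed (rule sq_int_measurable[OF assms(2)])

lemma pos_semidef_mat_symmetric:
  assumes "pos_semidef_mat S"
  shows "x \<bullet> (S *v y) = y \<bullet> (S *v x)"
proof -
  have "x v* S = S *v x"
    using assms transpose_matrix_vector[of S x] unfolding pos_semidef_mat_def by metis
  thus ?thesis using dot_lmul_matrix[of x S y] by (simp add: inner_commute)
qed

lemma pos_semidef_mat_diff_mat:
  fixes S :: "real^'n^'n"
  assumes "pos_semidef_mat (S - mat c)"
  shows "x \<bullet> (S *v y) = y \<bullet> (S *v x)" and "c * (x \<bullet> x) \<le> x \<bullet> (S *v x)"
proof -
  have "(S - mat c) *v z = S *v z - c *\<^sub>R z" for z
  proof -
    have "mat c = c *\<^sub>R (mat 1 :: real^'n^'n)"
      by (simp add: mat_def vec_eq_iff)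
    hence "mat c *v z = c *\<^sub>R z"
      by (simp flip: scaleR_matrix_vector_assoc)
    thus ?thesis by (simp add: matrix_vector_mult_diff_rdistrib)
  qed
  note * = this
  show "x \<bullet> (S *v y) = y \<bullet> (S *v x)"
    using pos_semidef_mat_symmetric[OF assms, of x y] by (simp add: * inner_diff_right inner_commute)
  have "0 \<le> x \<bullet> ((S - mat c) *v x)" using assms by (simp add: pos_semidef_mat_def)
  thus "c * (x \<bullet> x) \<le> x \<bullet> (S *v x)" by (simp add: * inner_diff_right)
qed

context
  fixes M :: "'a measure" and F :: "'a \<Rightarrow> real^'n^'m" and K :: real
  assumes F: "F \<in> borel_measurable M" "AE t in M. norm (F t) \<le> K"
begin

lemma sq_int_matrix_vector_mult:
  assumes "sq_int M f"
  shows "sq_int M (\<lambda>t. F t *v f t)"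
proof (rule sq_int_bound[OF assms])
  show "(\<lambda>t. F t *v f t) \<in> borel_measurable M"
    using F(1) sq_int_measurable[OF assms] by (rule borel_measurable_matrix_vector_mult)
  show "AE t in M. norm (F t *v f t) \<le> K * norm (f t)"
    using F(2)
  proof eventually_elim
    case (elim t)
    thus ?case using norm_matrix_vector_mult_le[of "F t" "f t"]
      by (meson mult_right_mono norm_ge_zero order_trans)
  qed
qed

lemma integrable_form: "sq_int M f \<Longrightarrow> sq_int M g \<Longrightarrow> integrable M (\<lambda>t. f t \<bullet> (F t *v g t))"
  by (intro integrable_inner_sq_int sq_int_matrix_vector_mult)

lemma form_combine:
  assumes "sq_int M f" "sq_int M g" "sq_int M h" "sq_int M k"
    and "AE t in M. k t = a *\<^sub>R f t + b *\<^sub>R g t"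
  shows "(LINT t|M. k t \<bullet> (F t *v h t)) =
    a * (LINT t|M. f t \<bullet> (F t *v h t)) + b * (LINT t|M. g t \<bullet> (F t *v h t))"
proof -
  have "(LINT t|M. k t \<bullet> (F t *v h t)) =
      (LINT t|M. a * (f t \<bullet> (F t *v h t)) + b * (g t \<bullet> (F t *v h t)))"
  proof (rule integral_cong_AE)
    show "AE t in M. k t \<bullet> (F t *v h t) = a * (f t \<bullet> (F t *v h t)) + b * (g t \<bullet> (F t *v h t))"
      using assms(5) by eventually_elim (simp add: inner_add_left)
  qed (use integrable_form assms(1-4) in auto)
  also have "\<dots> = a * (LINT t|M. f t \<bullet> (F t *v h t)) + b * (LINT t|M. g t \<bullet> (F t *v h t))"
    using integrable_form assms(1-4) by simp
  finally show ?thesis .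
qed

end

lemma form_commute:
  fixes F :: "'a \<Rightarrow> real^'n^'n"
  assumes "AE t in M. \<forall>x y. x \<bullet> (F t *v y) = y \<bullet> (F t *v x)"
    and "F \<in> borel_measurable M" "f \<in> borel_measurable M" "g \<in> borel_measurable M"
  shows "(LINT t|M. f t \<bullet> (F t *v g t)) = (LINT t|M. g t \<bullet> (F t *v f t))"
  using assms(2-) by (intro integral_cong_AE) (use assms(1) in \<open>auto elim!: eventually_mono\<close>)

section \<open>Representatives of square-integrable classes\<close>

lemma L2_rel_rep: "L2_rel (rep_L2 u) (rep_L2 u)"
  using Quotient3_rep_reflp[OF Quotient3_L2] .

text \<open>Representatives are chosen class by class, so linearity holds only almost everywhere:
  both sides represent the same class.\<close>

lemma rep_L2_combine:
  fixes u v :: "'a::euclidean_space L2"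
  shows "AE t in lebesgue. rep_L2 (a *\<^sub>R u + b *\<^sub>R v) t = a *\<^sub>R rep_L2 u t + b *\<^sub>R rep_L2 v t"
proof -
  have scale: "AE t in lebesgue. rep_L2 (c *\<^sub>R w) t = c *\<^sub>R rep_L2 w t" for c and w :: "'a L2"
  proof -
    have "L2_rel (\<lambda>t. c *\<^sub>R rep_L2 w t) (\<lambda>t. c *\<^sub>R rep_L2 w t)"
      using L2_rel_rep[of w] by (simp add: L2_rel_def square_integrable_scaleR)
    from rep_abs_rsp_left[OF Quotient3_L2, OF this] show ?thesis
      by (simp add: scaleR_L2_def L2_rel_def)
  qed
  have "L2_rel (\<lambda>t. rep_L2 w t + rep_L2 z t) (\<lambda>t. rep_L2 w t + rep_L2 z t)" for w z :: "'a L2"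
    using L2_rel_rep[of w] L2_rel_rep[of z] by (simp add: L2_rel_def square_integrable_add)
  hence "AE t in lebesgue. rep_L2 (w + z) t = rep_L2 w t + rep_L2 z t" for w z :: "'a L2"
    using rep_abs_rsp_left[OF Quotient3_L2, of "\<lambda>t. rep_L2 w t + rep_L2 z t"]
    by (simp add: plus_L2_def L2_rel_def)
  from this[of "a *\<^sub>R u" "b *\<^sub>R v"] scale[of a u] scale[of b v] show ?thesis
    by eventually_elim simp
qed

lemma sq_int_rep_L2: "sq_int (lebesgue_on {0..T}) (rep_L2 u)"
proof -
  have "square_integrable (rep_L2 u)" using L2_rel_rep[of u] by (simp add: L2_rel_def)
  thus ?thesis
    unfolding square_integrable_def sq_int_def
    using integrable_mult_indicator[of "{0..T}" lebesgue "\<lambda>t. (norm (rep_L2 u t))\<^sup>2"]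
    by (auto intro: measurable_restrict_space1 simp: integrable_restrict_space)
qed

text \<open>The inner product integrates over the whole line; vanishing off the interval reduces it
  to \<open>[0,T]\<close>, where the coefficient bounds hold.\<close>

lemma L2_on_inner_self:
  assumes "u \<in> L2_on T"
  shows "u \<bullet> u = (LINT t|lebesgue_on {0..T}. rep_L2 u t \<bullet> rep_L2 u t)"
proof -
  have "rep_L2 u \<in> borel_measurable lebesgue"
    using L2_rel_rep[of u] by (simp add: L2_rel_def square_integrable_def)
  hence meas: "(\<lambda>t. rep_L2 u t \<bullet> rep_L2 u t) \<in> borel_measurable lebesgue"
    by (intro borel_measurable_inner)
  have "(LINT t|lebesgue_on {0..T}. rep_L2 u t \<bullet> rep_L2 u t) =
      (LINT t|lebesgue. indicator {0..T} t *\<^sub>R (rep_L2 u t \<bullet> rep_L2 u t))"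
    by (rule integral_restrict_space) simp
  also have "\<dots> = (LINT t|lebesgue. rep_L2 u t \<bullet> rep_L2 u t)"
  proof (rule integral_cong_AE)
    have "AE t in lebesgue. t \<notin> {0<..<T} \<longrightarrow> rep_L2 u t = 0"
      using assms by (simp add: L2_on_def)
    thus "AE t in lebesgue. indicator {0..T} t *\<^sub>R (rep_L2 u t \<bullet> rep_L2 u t) = rep_L2 u t \<bullet> rep_L2 u t"
      by eventually_elim (auto simp: indicator_def)
  qed (use meas in \<open>auto intro!: borel_measurable_times borel_measurable_indicator\<close>)
  finally show ?thesis by (simp add: inner_L2_def)
qed

section \<open>State, cost and constraint of the control problem\<close>

locale lq_problem =
  fixes P :: "('n::finite, 'm::finite) lq_data" and \<rho> d K :: real
  assumes admissible: "lq_admissible P \<rho> d"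
    and A_norm: "AE s in lebesgue_on {0..horizon P}. norm (matA P s) \<le> K" and K_nonneg: "0 \<le> K"
begin

abbreviation "T \<equiv> horizon P"
abbreviation "M \<equiv> lebesgue_on {0..T}"

lemma T_pos: "0 < T" and d_pos: "0 < d" and \<rho>_pos: "0 < \<rho>"
  using admissible by (auto simp: lq_admissible_def)

sublocale linear_ode T K "matA P"
  using admissible A_norm K_nonneg
  by unfold_locales (auto simp: lq_admissible_def bounded_measurable_def)

lemma finite_measure_M: "finite_measure M"
  by (intro finite_measure_lebesgue_on) auto

lemma coefficient:
  shows B: "matB P \<in> borel_measurable M" "\<exists>c. AE t in M. norm (matB P t) \<le> c"
    and Q: "matQ P \<in> borel_measurable M" "\<exists>c. AE t in M. norm (matQ P t) \<le> c"
    and R: "matR P \<in> borel_measurable M" "\<exists>c. AE t in M. norm (matR P t) \<le> c"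
    and D: "matD P \<in> borel_measurable M" "\<exists>c. AE t in M. norm (matD P t) \<le> c"
  using admissible by (auto simp: lq_admissible_def bounded_measurable_def)

lemma
  shows Q_psd: "AE t in M. pos_semidef_mat (matQ P t)"
    and R_psd: "AE t in M. pos_semidef_mat (matR P t - mat \<rho>)"
    and D_psd: "AE t in M. pos_semidef_mat (matD P t - mat d)"
    and M_psd: "pos_semidef_mat (matM P)"
  using admissible by (auto simp: lq_admissible_def)

lemma symmetric:
  shows "AE t in M. \<forall>x y. x \<bullet> (matQ P t *v y) = y \<bullet> (matQ P t *v x)"
    and "AE t in M. \<forall>x y. x \<bullet> (matR P t *v y) = y \<bullet> (matR P t *v x)"
    and "AE t in M. \<forall>x y. x \<bullet> (matD P t *v y) = y \<bullet> (matD P t *v x)"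
  by (rule eventually_mono[OF Q_psd], blast intro: pos_semidef_mat_symmetric)
    (rule eventually_mono[OF R_psd] eventually_mono[OF D_psd], blast intro: pos_semidef_mat_diff_mat(1))+

definition forcing :: "(real^'m) L2 \<Rightarrow> real \<Rightarrow> real^'n" where
  "forcing u s = matB P s *v rep_L2 u s"

text \<open>Splits the affine map from controls to states: \<open>free_state\<close> carries the
  initial value, and \<open>response\<close> is linear in the control.\<close>

definition free_state :: "real \<Rightarrow> real^'n" where
  "free_state = sol (init P) (\<lambda>s. 0)"

definition response :: "(real^'m) L2 \<Rightarrow> real \<Rightarrow> real^'n" where
  "response u = sol 0 (forcing u)"

lemma integrable_forcing: "integrable M (forcing u)"
proof -
  obtain c where "AE t in M. norm (matB P t) \<le> c" using B by blast
  thus ?thesis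
    unfolding forcing_def
    by (intro integrable_sq_int finite_measure_M sq_int_matrix_vector_mult[OF B(1)] sq_int_rep_L2)
qed

lemma rep_L2_combine_M: "AE t in M. rep_L2 (a *\<^sub>R u + b *\<^sub>R v) t = a *\<^sub>R rep_L2 u t + b *\<^sub>R rep_L2 v t"
  using rep_L2_combine[of a u b v] by (auto simp: AE_restrict_space_iff elim: eventually_mono)

lemma forcing_combine: "AE s in M. forcing (a *\<^sub>R u + b *\<^sub>R v) s = a *\<^sub>R forcing u s + b *\<^sub>R forcing v s"
  using rep_L2_combine_M[of a u b v] by eventually_elim (simp add: forcing_def algebra_simps)

lemma response_combine:
  "t \<in> {0..T} \<Longrightarrow> response (a *\<^sub>R u + b *\<^sub>R v) t = a *\<^sub>R response u t + b *\<^sub>R response v t"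
  using sol_combine[OF integrable_forcing integrable_forcing
      borel_measurable_integrable[OF integrable_forcing] forcing_combine, where x\<^sub>0 = 0 and y\<^sub>0 = 0]
  by (simp add: response_def)

lemma lq_state_eq:
  assumes "t \<in> {0..T}"
  shows "lq_state P u t = free_state t + response u t"
proof -
  have "lq_state P u = sol (init P) (forcing u)"
    unfolding lq_state_def sol_def solves_state_def solution_def forcing_def ..
  thus ?thesis
    using sol_combine[of "\<lambda>s. 0" "forcing u" "forcing u" 1 1 t "init P" 0] assms
      integrable_forcing borel_measurable_integrable[OF integrable_forcing]
    by (simp add: free_state_def response_def)
qed

lemma sq_int_sol:
  assumes "integrable M g"
  shows "sq_int M (sol x g)"
proof -
  obtain c where "\<And>s. s \<in> {0..T} \<Longrightarrow> norm (sol x g s) \<le> c"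
    using continuous_bounded[OF sol_continuous[OF assms]] by blast
  moreover have "sol x g \<in> borel_measurable M"
    using sol_continuous[OF assms] by (intro continuous_imp_measurable_on_sets_lebesgue) auto
  ultimately show ?thesis
    by (intro sq_int_bounded[of _ _ c] finite_measure_M AE_I2) auto
qed

lemma sq_int_states: "sq_int M free_state" "sq_int M (response u)"
  unfolding free_state_def response_def by (auto intro: sq_int_sol integrable_forcing)

text \<open>The polarised state cost without the factor \<open>1/2\<close>; as a symmetric bilinear
  form it allows the affine state to be expanded.\<close>

definition state_form :: "(real \<Rightarrow> real^'n) \<Rightarrow> (real \<Rightarrow> real^'n) \<Rightarrow> real" where
  "state_form x y = x T \<bullet> (matM P *v y T) + (LINT t|M. x t \<bullet> (matQ P t *v y t))"

definition cost_form :: "(real^'m) L2 \<Rightarrow> (real^'m) L2 \<Rightarrow> real" where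
  "cost_form u v = state_form (response u) (response v) + (LINT t|M. rep_L2 u t \<bullet> (matR P t *v rep_L2 v t))"

definition constraint_form :: "(real^'m) L2 \<Rightarrow> (real^'m) L2 \<Rightarrow> real" where
  "constraint_form u v = (LINT t|M. rep_L2 u t \<bullet> (matD P t *v rep_L2 v t))"

lemma state_form_commute: "sq_int M x \<Longrightarrow> sq_int M y \<Longrightarrow> state_form x y = state_form y x"
  unfolding state_form_def
  using pos_semidef_mat_symmetric[OF M_psd, of "x T" "y T"]
    form_commute[OF symmetric(1) Q(1) sq_int_measurable sq_int_measurable, of x y] by simp

text \<open>The relation is asked for on \<open>[0,T]\<close> only, because \<open>response\<close>
  is known to be linear there and is unspecified elsewhere.\<close>

lemma state_form_combine:
  assumes "sq_int M x" "sq_int M y" "sq_int M z" "sq_int M w"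
    and "\<And>t. t \<in> {0..T} \<Longrightarrow> w t = a *\<^sub>R x t + b *\<^sub>R y t"
  shows "state_form w z = a * state_form x z + b * state_form y z"
proof -
  obtain c where c: "AE t in M. norm (matQ P t) \<le> c" using Q by blast
  have "AE t in M. w t = a *\<^sub>R x t + b *\<^sub>R y t" using assms(5) by (intro AE_I2) auto
  thus ?thesis
    unfolding state_form_def form_combine[OF Q(1) c assms(1-4)]
    using assms(5)[of T] T_pos
    by (subst form_combine[OF Q(1) c assms(1-4)]) (auto simp: inner_add_left algebra_simps)
qed

lemma state_form_nonneg: "0 \<le> state_form x x"
  unfolding state_form_def
proof (rule add_nonneg_nonneg)
  show "0 \<le> x T \<bullet> (matM P *v x T)" using M_psd by (simp add: pos_semidef_mat_def)
  show "0 \<le> (LINT t|M. x t \<bullet> (matQ P t *v x t))"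
    by (intro integral_nonneg_AE eventually_mono[OF Q_psd]) (simp add: pos_semidef_mat_def)
qed

lemma constraint_form_combine:
  "constraint_form (a *\<^sub>R u + b *\<^sub>R v) w = a * constraint_form u w + b * constraint_form v w"
proof -
  obtain c where c: "AE t in M. norm (matD P t) \<le> c" using D by blast
  show ?thesis
    unfolding constraint_form_def
    by (rule form_combine[OF D(1) c sq_int_rep_L2 sq_int_rep_L2 sq_int_rep_L2 sq_int_rep_L2 rep_L2_combine_M])
qed

lemma cost_form_combine:
  "cost_form (a *\<^sub>R u + b *\<^sub>R v) w = a * cost_form u w + b * cost_form v w"
proof -
  obtain c where c: "AE t in M. norm (matR P t) \<le> c" using R by blast
  show ?thesis
    using form_combine[OF R(1) c sq_int_rep_L2 sq_int_rep_L2 sq_int_rep_L2 sq_int_rep_L2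
        rep_L2_combine_M[of a u b v], of w]
      state_form_combine[OF sq_int_states(2) sq_int_states(2) sq_int_states(2) sq_int_states(2)
        response_combine[of _ a u b v], of w]
    by (simp add: cost_form_def algebra_simps)
qed

lemma constraint_form_commute: "constraint_form u v = constraint_form v u"
  unfolding constraint_form_def
  by (intro form_commute symmetric D sq_int_measurable sq_int_rep_L2)

lemma cost_form_commute: "cost_form u v = cost_form v u"
  unfolding cost_form_def
  using form_commute[OF symmetric(2) R(1) sq_int_measurable sq_int_measurable, OF sq_int_rep_L2 sq_int_rep_L2]
    state_form_commute[OF sq_int_states(2) sq_int_states(2)] by metis

lemma control_form_lower_bound:
  assumes F: "F \<in> borel_measurable M" "\<exists>c. AE t in M. norm (F t) \<le> c"
    and psd: "AE t in M. pos_semidef_mat (F t - mat c)" and u: "u \<in> L2_on T"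
  shows "c * (u \<bullet> u) \<le> (LINT t|M. rep_L2 u t \<bullet> (F t *v rep_L2 u t))"
proof -
  obtain k where k: "AE t in M. norm (F t) \<le> k" using F by blast
  have "c * (u \<bullet> u) = (LINT t|M. c * (rep_L2 u t \<bullet> rep_L2 u t))"
    by (simp add: L2_on_inner_self[OF u])
  also have "\<dots> \<le> (LINT t|M. rep_L2 u t \<bullet> (F t *v rep_L2 u t))"
  proof (rule integral_mono_AE)
    show "integrable M (\<lambda>t. c * (rep_L2 u t \<bullet> rep_L2 u t))"
      by (intro integrable_mult_right integrable_inner_sq_int sq_int_rep_L2)
    show "integrable M (\<lambda>t. rep_L2 u t \<bullet> (F t *v rep_L2 u t))"
      by (intro integrable_form[OF F(1) k] sq_int_rep_L2)
    show "AE t in M. c * (rep_L2 u t \<bullet> rep_L2 u t) \<le> rep_L2 u t \<bullet> (F t *v rep_L2 u t)"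
      using psd by eventually_elim (auto intro: pos_semidef_mat_diff_mat(2))
  qed
  finally show ?thesis .
qed

lemma constraint_form_ge: "u \<in> L2_on T \<Longrightarrow> d * (u \<bullet> u) \<le> constraint_form u u"
  unfolding constraint_form_def using control_form_lower_bound[OF D D_psd] .

lemma cost_form_ge: "u \<in> L2_on T \<Longrightarrow> \<rho> * (u \<bullet> u) \<le> cost_form u u"
  unfolding cost_form_def using control_form_lower_bound[OF R R_psd] state_form_nonneg
  by (intro add_increasing) auto

lemma lq_constraint_eq: "lq_constraint P u = constraint_form u u"
  by (simp add: lq_constraint_def constraint_form_def)

text \<open>Expanding the state \<open>free_state + response u\<close> separates a quadratic, a
  linear and a constant part.\<close>

lemma lq_cost_eq:
  "lq_cost P u = 1/2 * cost_form u u + state_form (response u) free_state + 1/2 * state_form free_state free_state"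
proof -
  \<comment> \<open>A globally defined sum, written with scalars \<open>1\<close> to match the
    combination lemmas; \<open>lq_state\<close> is known to agree with it only on
    \<open>[0,T]\<close>.\<close>
  define x where "x = (\<lambda>t. 1 *\<^sub>R free_state t + 1 *\<^sub>R response u t)"
  obtain c where c: "AE t in M. norm (matQ P t) \<le> c" using Q by blast
  obtain k where k: "AE t in M. norm (matR P t) \<le> k" using R by blast
  have x_eq: "x t = lq_state P u t" if "t \<in> {0..T}" for t
    using lq_state_eq[OF that, of u] by (simp add: x_def)
  have x: "sq_int M x"
  proof -
    have "solution (1 *\<^sub>R init P + 1 *\<^sub>R 0) (forcing u) x"
      unfolding x_def free_state_def response_def
      by (rule solution_combine[OF solution_sol solution_sol])
        (use integrable_forcing in auto)
    hence cont: "continuous_on {0..T} x" by (rule solution_continuous)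
    then obtain c where "\<And>s. s \<in> {0..T} \<Longrightarrow> norm (x s) \<le> c" using continuous_bounded by blast
    thus ?thesis
      using cont by (intro sq_int_bounded[of _ _ c] finite_measure_M AE_I2
          continuous_imp_measurable_on_sets_lebesgue) auto
  qed
  have "lq_cost P u = 1/2 * (x T \<bullet> (matM P *v x T)) +
      1/2 * (LINT t|M. x t \<bullet> (matQ P t *v x t) + rep_L2 u t \<bullet> (matR P t *v rep_L2 u t))"
  proof -
    have "(LINT t|M. x t \<bullet> (matQ P t *v x t) + rep_L2 u t \<bullet> (matR P t *v rep_L2 u t)) =
        (LINT t|M. lq_state P u t \<bullet> (matQ P t *v lq_state P u t) + rep_L2 u t \<bullet> (matR P t *v rep_L2 u t))"
      by (rule Bochner_Integration.integral_cong) (simp_all add: x_eq)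
    thus ?thesis using T_pos x_eq[of T] by (simp add: lq_cost_def)
  qed
  also have "\<dots> = 1/2 * (state_form x x + (LINT t|M. rep_L2 u t \<bullet> (matR P t *v rep_L2 u t)))"
    using integrable_form[OF Q(1) c x x] integrable_form[OF R(1) k sq_int_rep_L2 sq_int_rep_L2]
    by (simp add: state_form_def)
  also have "state_form x x = state_form free_state x + state_form (response u) x"
    using state_form_combine[OF sq_int_states x x, of 1 1] by (simp add: x_def)
  also have "state_form free_state x = state_form x free_state"
    by (intro state_form_commute sq_int_states x)
  also have "\<dots> = state_form free_state free_state + state_form (response u) free_state"
    using state_form_combine[OF sq_int_states sq_int_states(1) x, of 1 1] by (simp add: x_def)
  also have "state_form (response u) x = state_form x (response u)"
    by (intro state_form_commute sq_int_states x)
  also have "\<dots> = state_form free_state (response u) + state_form (response u) (response u)"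
    using state_form_combine[OF sq_int_states sq_int_states(2) x, of 1 1] by (simp add: x_def)
  also have "state_form free_state (response u) = state_form (response u) free_state"
    by (intro state_form_commute sq_int_states)
  finally have *: "lq_cost P u = 1/2 * (state_form free_state free_state + state_form (response u) free_state +
      (state_form (response u) free_state + state_form (response u) (response u)) +
      (LINT t|M. rep_L2 u t \<bullet> (matR P t *v rep_L2 u t)))" .
  have "1/2 * (a + b + (b + c) + i) = 1/2 * (c + i) + b + 1/2 * a" for a b c i :: real
    by (simp add: field_simps)
  thus ?thesis unfolding * cost_form_def by blast
qed

lemma free_form_combine:
  "state_form (response (a *\<^sub>R u + b *\<^sub>R v)) free_state =
    a * state_form (response u) free_state + b * state_form (response v) free_state"
  by (rule state_form_combine[OF sq_int_states(2) sq_int_states(2) sq_int_states(1) sq_int_states(2) response_combine])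

end

section \<open>The operators representing cost and constraint\<close>

context lq_problem
begin

context
  fixes H E :: "(real^'m) L2 set"
  assumes onb: "orthonormal_span H E" and H_subset: "H \<subseteq> L2_on T"
begin

interpretation orthonormal_span H E by (rule onb)

text \<open>Riesz representation of \<open>constraint_form\<close> supplies a witness for the
  choice, so the chosen operator has the specified quadratic form; that form is coercive with
  constant \<open>d\<close>.\<close>

lemma lq_constraint_op:
  shows "pos_def_on H (lq_constraint_op P H)"
    and "\<And>u. u \<in> H \<Longrightarrow> lq_constraint P u = u \<bullet> lq_constraint_op P H u"
proof -
  obtain F where "self_adjoint_on H F" "\<And>u v. u \<in> H \<Longrightarrow> v \<in> H \<Longrightarrow> constraint_form u v = u \<bullet> F v"
    using riesz_operator[of constraint_form] constraint_form_commute
      constraint_form_combine[of 1 _ 1] constraint_form_combine[of _ _ 0] by auto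
  hence "self_adjoint_on H F \<and> (\<forall>u\<in>H. lq_constraint P u = u \<bullet> F u)"
    by (simp add: lq_constraint_eq)
  hence *: "self_adjoint_on H (lq_constraint_op P H) \<and>
      (\<forall>u\<in>H. lq_constraint P u = u \<bullet> lq_constraint_op P H u)"
    unfolding lq_constraint_op_def
    by (rule someI[of "\<lambda>F. self_adjoint_on H F \<and> (\<forall>u\<in>H. lq_constraint P u = u \<bullet> F u)"])
  thus eq: "\<And>u. u \<in> H \<Longrightarrow> lq_constraint P u = u \<bullet> lq_constraint_op P H u" by blast
  have "0 < u \<bullet> lq_constraint_op P H u" if "u \<in> H" "u \<noteq> 0" for u
  proof -
    have "0 < d * (u \<bullet> u)" using d_pos that by simp
    also have "\<dots> \<le> lq_constraint P u"
      using constraint_form_ge[of u] H_subset that by (auto simp: lq_constraint_eq)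
    finally show ?thesis using eq that by simp
  qed
  thus "pos_def_on H (lq_constraint_op P H)" using * by (simp add: pos_def_on_def)
qed

text \<open>A priori the chosen operator may come with linear and constant parts other than the
  constructed ones, so its definiteness is derived from the values of the cost.\<close>

lemma lq_cost_op:
  obtains r g where "r \<in> H" "\<And>u. u \<in> H \<Longrightarrow> lq_cost P u = 1/2 * (u \<bullet> lq_cost_op P H u) + r \<bullet> u + g"
    "pos_def_on H (lq_cost_op P H)"
proof -
  define Q where "Q F \<longleftrightarrow> self_adjoint_on H F \<and>
     (\<exists>r\<in>H. \<exists>g. \<forall>u\<in>H. lq_cost P u = 1/2 * (u \<bullet> F u) + r \<bullet> u + g)" for F
  obtain F where F: "self_adjoint_on H F" "\<And>u v. u \<in> H \<Longrightarrow> v \<in> H \<Longrightarrow> cost_form u v = u \<bullet> F v"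
    using riesz_operator[of cost_form] cost_form_commute
      cost_form_combine[of 1 _ 1] cost_form_combine[of _ _ 0] by auto
  obtain l where l: "l \<in> H" "\<And>u. u \<in> H \<Longrightarrow> state_form (response u) free_state = l \<bullet> u"
    using riesz[of "\<lambda>u. state_form (response u) free_state"]
      free_form_combine[of 1 _ 1] free_form_combine[of _ _ 0] by auto
  have "Q F" using F l unfolding Q_def lq_cost_eq by auto
  hence "Q (lq_cost_op P H)"
    unfolding lq_cost_op_def Q_def[symmetric] by (rule someI[of Q])
  then obtain r g where sa: "self_adjoint_on H (lq_cost_op P H)" and r: "r \<in> H"
    and eq: "\<And>u. u \<in> H \<Longrightarrow> lq_cost P u = 1/2 * (u \<bullet> lq_cost_op P H u) + r \<bullet> u + g"
    unfolding Q_def by blast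
  have "0 < u \<bullet> lq_cost_op P H u" if u: "u \<in> H" "u \<noteq> 0" for u
  proof -
    have scale: "lq_cost_op P H (c *\<^sub>R u) = c *\<^sub>R lq_cost_op P H u" for c
      using sa u by (simp add: self_adjoint_on_def)
    \<comment> \<open>The second difference along the line through \<open>u\<close> cancels linear
      and constant parts, so it equals both \<open>u \<bullet> lq_cost_op P H u\<close> and
      \<open>cost_form u u\<close>.\<close>
    have "lq_cost P ((-1) *\<^sub>R u) + lq_cost P u - 2 * lq_cost P (0 *\<^sub>R u) = u \<bullet> lq_cost_op P H u"
      unfolding eq[OF H_closed(3)[OF u(1)]] eq[OF u(1)] scale by simp
    moreover have "lq_cost P ((-1) *\<^sub>R u) + lq_cost P u - 2 * lq_cost P (0 *\<^sub>R u) = cost_form u u"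
    proof -
      have "cost_form (c *\<^sub>R u) (c *\<^sub>R u) = c\<^sup>2 * cost_form u u" for c
        using cost_form_combine[of c u 0 u] cost_form_commute[of _ "c *\<^sub>R u"]
        by (metis add.right_neutral mult.assoc mult_zero_left power2_eq_square scaleR_zero_left)
      moreover have "state_form (response (c *\<^sub>R u)) free_state = c * state_form (response u) free_state" for c
        using free_form_combine[of c u 0 u] by simp
      ultimately show ?thesis
        unfolding lq_cost_eq by (simp del: scaleR_minus_left scaleR_minus1_left scaleR_zero_left scaleR_one)
    qed
    moreover have "0 < \<rho> * (u \<bullet> u)" using \<rho>_pos u by simp
    moreover have "\<rho> * (u \<bullet> u) \<le> cost_form u u" using cost_form_ge H_subset u by blast
    ultimately show ?thesis by linarith
  qed
  hence "pos_def_on H (lq_cost_op P H)" using sa by (simp add: pos_def_on_def)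
  thus thesis using that r eq by blast
qed

end

end

theorem theorem4p4:
  fixes P :: "('n::finite, 'm::finite) lq_data"
    and H :: "(real^'m) L2 set"
    and \<rho> d \<beta> :: real
  assumes "lq_admissible P \<rho> d"
    and "subspace H" and "\<exists>S. finite S \<and> span S = H" and "H \<subseteq> L2_on (horizon P)"
    and "0 < \<beta>" and "\<beta> \<in> interior (lq_constraint P ` H)"
  shows
    "(\<comment> \<open>setting\<close>
      pos_def_on H (lq_cost_op P H) \<and> pos_def_on H (lq_constraint_op P H) \<and>
      (\<exists>\<rho>\<^sub>0\<in>H. \<exists>\<gamma>\<^sub>0. \<forall>u\<in>H.
         lq_cost P u = 1/2 * (u \<bullet> lq_cost_op P H u) + \<rho>\<^sub>0 \<bullet> u + \<gamma>\<^sub>0) \<and>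
      (\<forall>u\<in>H. lq_constraint P u = u \<bullet> lq_constraint_op P H u) \<and>
      dual_endpoint P H < 0 \<and>
      dual_interval P H = {dual_endpoint P H<..})
   \<and> (\<comment> \<open>(i) no duality gap\<close>
      \<exists>\<mu>s \<in> closure (dual_interval P H). \<exists>us \<in> H.
        dual_optimal P H \<beta> \<mu>s \<and> lq_constraint P us = \<beta> \<and>
        lq_value P H \<beta> = ereal (lq_cost P us) \<and>
        ereal (lq_cost P us) = lq_dual P H \<mu>s - ereal (\<mu>s * \<beta>) \<and>
        is_max (\<lambda>\<mu>. lq_dual P H \<mu> - ereal (\<mu> * \<beta>)) (closure (dual_interval P H)) (lq_value P H \<beta>) \<and>
        is_max (\<lambda>\<mu>. INF u\<in>H. ereal (lq_cost P u + \<mu> * (lq_constraint P u - \<beta>))) UNIV (lq_value P H \<beta>))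
   \<and> (\<comment> \<open>(ii) convexity\<close>
      proper_closed_convex (lq_value P H) \<and>
      {b. lq_value P H b < \<infinity>} = lq_constraint P ` H \<and> is_interval (lq_constraint P ` H) \<and>
      (\<forall>b. lq_value P H b = (SUP \<mu>. lq_dual P H \<mu> - ereal (\<mu> * b))))
   \<and> (\<comment> \<open>(iii) envelope\<close>
      (\<forall>b\<in>interior (lq_constraint P ` H). \<forall>v.
         ((\<lambda>c. real_of_ereal (lq_value P H c)) has_real_derivative v) (at b) \<longrightarrow>
         (\<forall>\<mu>. dual_optimal P H b \<mu> \<longrightarrow> v = - \<mu>)) \<and>
      (\<forall>b\<^sub>1 b\<^sub>2 \<mu>\<^sub>1 \<mu>\<^sub>2. b\<^sub>1 < b\<^sub>2 \<longrightarrow> dual_optimal P H b\<^sub>1 \<mu>\<^sub>1 \<longrightarrow> dual_optimal P H b\<^sub>2 \<mu>\<^sub>2 \<longrightarrow> \<mu>\<^sub>2 \<le> \<mu>\<^sub>1))"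
proof -
  obtain K where K: "AE s in lebesgue_on {0..horizon P}. norm (matA P s) \<le> K"
    using assms(1) by (auto simp: lq_admissible_def bounded_measurable_def)
  \<comment> \<open>\<open>max 0 K\<close> makes the essential bound nonnegative, as the Picard
    estimates require.\<close>
  interpret lq: lq_problem P \<rho> d "max 0 K"
    using assms(1) K by unfold_locales (auto elim!: eventually_mono)
  obtain E where E: "orthonormal_span H E"
    using assms(3) orthonormal_span_exists by metis
  obtain r g where r: "r \<in> H"
    and J: "\<And>u. u \<in> H \<Longrightarrow> lq_cost P u = 1/2 * (u \<bullet> lq_cost_op P H u) + r \<bullet> u + g"
    and F_pos: "pos_def_on H (lq_cost_op P H)"
    using lq.lq_cost_op[OF E assms(4)] by metis
  note C = lq.lq_constraint_op[OF E assms(4)]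
  \<comment> \<open>For \<open>H = {0}\<close> the range would be a single point, which has empty
    interior.\<close>
  have "H \<noteq> {0}"
    using assms(6) empty_interior_finite[of "lq_constraint P ` H"] by auto
  interpret quadratic_program H E "lq_cost_op P H" "lq_constraint_op P H" r g "lq_cost P" "lq_constraint P"
    using E F_pos C r J \<open>H \<noteq> {0}\<close>
    by (intro quadratic_program.intro quadratic_program_axioms.intro)
  \<comment> \<open>The notions of the abstract program unfold to those of the control problem, so
    its results transfer verbatim.\<close>
  have primal: "primal = lq_value P H" and dual: "dual = lq_dual P H" and opt: "optimal = dual_optimal P H"
    by (auto simp: fun_eq_iff primal_def lq_value_def dual_def lq_dual_def optimal_def dual_optimal_def)
  have endpoint: "endpoint = dual_endpoint P H"
    by (simp add: endpoint_def dual_endpoint_def)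
  have interval: "dual_interval P H = {dual_endpoint P H<..}"
    using pencil_iff by (auto simp: dual_interval_def endpoint)
  have closure: "closure (dual_interval P H) = {dual_endpoint P H..}"
    by (simp add: interval)
  show ?thesis
  proof (intro conjI)
    show "\<exists>\<mu>s \<in> closure (dual_interval P H). \<exists>us \<in> H.
        dual_optimal P H \<beta> \<mu>s \<and> lq_constraint P us = \<beta> \<and>
        lq_value P H \<beta> = ereal (lq_cost P us) \<and>
        ereal (lq_cost P us) = lq_dual P H \<mu>s - ereal (\<mu>s * \<beta>) \<and>
        is_max (\<lambda>\<mu>. lq_dual P H \<mu> - ereal (\<mu> * \<beta>)) (closure (dual_interval P H)) (lq_value P H \<beta>) \<and>
        is_max (\<lambda>\<mu>. INF u\<in>H. ereal (lq_cost P u + \<mu> * (lq_constraint P u - \<beta>))) UNIV (lq_value P H \<beta>)"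
      using strong_duality[OF assms(5)] unfolding closure primal dual opt endpoint .
    show "\<forall>b\<in>interior (lq_constraint P ` H). \<forall>v.
         ((\<lambda>c. real_of_ereal (lq_value P H c)) has_real_derivative v) (at b) \<longrightarrow>
         (\<forall>\<mu>. dual_optimal P H b \<mu> \<longrightarrow> v = - \<mu>)"
      using envelope unfolding interior_range_C primal opt by auto
    show "\<forall>b\<^sub>1 b\<^sub>2 \<mu>\<^sub>1 \<mu>\<^sub>2. b\<^sub>1 < b\<^sub>2 \<longrightarrow> dual_optimal P H b\<^sub>1 \<mu>\<^sub>1 \<longrightarrow> dual_optimal P H b\<^sub>2 \<mu>\<^sub>2 \<longrightarrow> \<mu>\<^sub>2 \<le> \<mu>\<^sub>1"
      using optimal_antimono unfolding opt by blast
    show "proper_closed_convex (lq_value P H)"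
      using proper_closed_convex_primal unfolding primal .
    show "{b. lq_value P H b < \<infinity>} = lq_constraint P ` H"
      using primal_finite_iff unfolding primal by blast
    show "is_interval (lq_constraint P ` H)"
      by (simp add: range_C)
    show "\<forall>b. lq_value P H b = (SUP \<mu>. lq_dual P H \<mu> - ereal (\<mu> * b))"
      using primal_eq_SUP unfolding primal dual by blast
    show "dual_endpoint P H < 0"
      using endpoint_neg by (simp add: endpoint)
  qed (use F_pos C r J interval in auto)
qed

end
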